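(* There exist positive absolute constants $c, C$ such that the following holds. Let $n\in\mathbb{N}^*$ and $\beta>0$, and let $\sigma$ be drawn from $\mathbb{P}_{n,\beta}$. Then for any $s\in[n]$, $$c\,\min\{e^{-2\beta}\max\{\beta^{-2},1\},n-1\}\;\le\;\mathbb{E}[\max(\mathcal{C}_s(\sigma))-\min(\mathcal{C}_s(\sigma))]\;\le\; C\,\min\{e^{-2\beta}\max\{\beta^{-2},1\},n-1\}.$$
   Context: $\mathbb{N}^*$ is the set of positive integers and $[n]=\{1,\dots,n\}$. $S_n$ is the symmetric group on $[n]$. For $\sigma,\tau\in S_n$, $H(\sigma,\tau)=\sum_{j=1}^n|\sigma(j)-\tau(j)|$, and $Id$ is the identity permutation. $\mathbb{P}_{n,\beta}$ (the Mallows model with the $L^1$ distance) is the probability measure on $S_n$ given by $\mathbb{P}_{n,\beta}(\sigma)=Z_{n,\beta}^{-1}\exp(-\beta H(\sigma,Id))$, where $Z_{n,\beta}$ is the normalizing constant. $\mathcal{C}_s(\sigma)\subseteq[n]$ is the set of points in the cycle of $\sigma$ that contains $s$. *)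

theory Defs
  imports "HOL-Probability.Probability" "HOL-Combinatorics.Orbits"
begin

text \<open>
  The symmetric group on \<open>[n]\<close> is the set of functions \<open>\<sigma> :: nat \<Rightarrow> nat\<close> with \<open>\<sigma> permutes {1..n}\<close>
  (bijections that fix every point outside \<open>{1..n}\<close>).
\<close>

definition L1_dist :: "nat \<Rightarrow> (nat \<Rightarrow> nat) \<Rightarrow> (nat \<Rightarrow> nat) \<Rightarrow> real" where
  "L1_dist n \<sigma> \<tau> = (\<Sum>j = 1..n. \<bar>real (\<sigma> j) - real (\<tau> j)\<bar>)"

definition mallows_Z :: "nat \<Rightarrow> real \<Rightarrow> real" where
  "mallows_Z n \<beta> = (\<Sum>\<sigma> | \<sigma> permutes {1..n}. exp (- \<beta> * L1_dist n \<sigma> id))"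

definition mallows_pmf :: "nat \<Rightarrow> real \<Rightarrow> (nat \<Rightarrow> nat) pmf" where
  "mallows_pmf n \<beta> = embed_pmf (\<lambda>\<sigma>.
     if \<sigma> permutes {1..n} then exp (- \<beta> * L1_dist n \<sigma> id) / mallows_Z n \<beta> else 0)"

lemma finite_perms: "finite {\<sigma> :: nat \<Rightarrow> nat. \<sigma> permutes {1..n}}"
  by (rule finite_permutations) simp

lemma mallows_Z_pos: "mallows_Z n \<beta> > 0"
  unfolding mallows_Z_def
  by (rule sum_pos[OF finite_perms]) (auto intro: permutes_id)

lemma pmf_mallows:
  "pmf (mallows_pmf n \<beta>) \<sigma> =
     (if \<sigma> permutes {1..n} then exp (- \<beta> * L1_dist n \<sigma> id) / mallows_Z n \<beta> else 0)"
  unfolding mallows_pmf_def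
proof (rule pmf_embed_pmf)
  let ?f = "\<lambda>\<sigma>. if \<sigma> permutes {1..n} then exp (- \<beta> * L1_dist n \<sigma> id) / mallows_Z n \<beta> else 0"
  let ?S = "{\<sigma> :: nat \<Rightarrow> nat. \<sigma> permutes {1..n}}"
  show nonneg: "0 \<le> ?f \<sigma>" for \<sigma>
    using mallows_Z_pos[of n \<beta>] by simp
  have "(\<integral>\<^sup>+\<sigma>. ennreal (?f \<sigma>) \<partial>count_space UNIV) = (\<Sum>\<sigma>\<in>?S. ennreal (?f \<sigma>))"
    by (rule nn_integral_count_space'[OF finite_perms]) auto
  also have "\<dots> = ennreal (\<Sum>\<sigma>\<in>?S. ?f \<sigma>)"
    by (rule sum_ennreal) (rule nonneg)
  also have "(\<Sum>\<sigma>\<in>?S. ?f \<sigma>) = mallows_Z n \<beta> / mallows_Z n \<beta>"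
    by (simp add: mallows_Z_def flip: sum_divide_distrib)
  also have "\<dots> = 1"
    using mallows_Z_pos[of n \<beta>] by simp
  finally show "(\<integral>\<^sup>+\<sigma>. ennreal (?f \<sigma>) \<partial>count_space UNIV) = 1"
    by simp
qed

lemma set_pmf_mallows: "set_pmf (mallows_pmf n \<beta>) = {\<sigma>. \<sigma> permutes {1..n}}"
  using mallows_Z_pos[of n \<beta>] by (auto simp: set_pmf_eq pmf_mallows)

text \<open>
  The library's \<open>orbit \<sigma> s\<close> collects the iterates \<open>(\<sigma> ^^ k) s\<close> with \<open>k > 0\<close>; for a permutation
  of a finite set this contains \<open>s\<close> and is the cycle of \<open>\<sigma>\<close> through \<open>s\<close>. In particular
  the sets whose maximum and minimum are taken are finite and nonempty.
\<close>

abbreviation cycle_of :: "nat \<Rightarrow> (nat \<Rightarrow> nat) \<Rightarrow> nat set" where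
  "cycle_of s \<sigma> \<equiv> orbit \<sigma> s"

lemma cycle_of_self_subset:
  assumes "\<sigma> permutes {1..n}" "s \<in> {1..n}"
  shows "s \<in> cycle_of s \<sigma>" "cycle_of s \<sigma> \<subseteq> {1..n}"
proof -
  show "s \<in> cycle_of s \<sigma>"
    using assms(1) by (meson finite_atLeastAtMost permutation_permutes permutation_self_in_orbit)
  show "cycle_of s \<sigma> \<subseteq> {1..n}"
    using assms by (rule permutes_orbit_subset)
qed

end

theory Submission
  imports Defs
begin

text \<open>
  Cut the line between \<open>k\<close> and \<open>k + 1\<close> and let \<open>flux k \<sigma>\<close> be the number of \<open>j \<le> k\<close> with
  \<open>\<sigma> j > k\<close>. Seen from the left of the cut, \<open>\<sigma>\<close> is a union of closed cycles and of exactly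
  \<open>flux k \<sigma>\<close> open paths, each with an entry point and an exit point. If the cycle of \<open>s\<close> crosses the
  cut, then it is closed at the point \<open>k + 1\<close> precisely when the exit of its path is sent to
  \<open>k + 1\<close> and \<open>k + 1\<close> is sent to the entry of the same path. For small \<open>\<beta>\<close> there are typically about \<open>1 / \<beta>\<close> open
  paths to choose from at both ends, so this has probability about \<open>\<beta>\<^sup>2\<close>, and the cycle of \<open>s\<close> continues to the right
  for about \<open>1 / \<beta>\<^sup>2\<close> further steps, unless it first meets the end \<open>n\<close>.

  Every estimate below comes from one device: replace \<open>\<sigma>\<close> by \<open>\<sigma> \<circ> (i j)\<close>. Only two summands of the
  \<open>L\<^sup>1\<close> distance change, so the ratio of the two probabilities is explicit, and the map
  \<open>(\<sigma>, i, j) \<mapsto> (\<sigma> \<circ> (i j), i, j)\<close> is an involution. A family of such exchanges therefore bounds one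
  expectation by another (lemma \<open>exchange_bound\<close>), at the price of a sum over the pairs \<open>(i, j)\<close>
  compatible with the new permutation. These sums are geometric with ratio \<open>q = exp (- 2 * \<beta>)\<close>, and
  \<open>K = 1 / (1 - q)\<close>, which is of order \<open>max (1 / \<beta>) 1\<close>, is the natural length scale.

  Upper bound. Undoing a pair of opposite crossings of the cut shows that, conditionally on the cycle
  of \<open>s\<close> crossing it, the second moment of the flux is \<open>O(K\<^sup>2)\<close> (\<open>second_moment_flux_crosses\<close>).
  Redirecting the exit and the entry of the path of \<open>s\<close> to the point \<open>k + 1\<close> costs a factor
  \<open>flux k \<sigma> + 2 * K\<close> each (\<open>prob_closes_ge\<close>), so the cycle closes at each step with conditional
  probability at least of order \<open>1 / K\<^sup>2\<close> (\<open>crosses_decay\<close>). Telescoping gives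
  \<open>E (Max - s) = O(K\<^sup>2)\<close> times the probability of crossing at all, and the latter is
  \<open>O(q * K\<^sup>2)\<close>, which provides the factor \<open>exp (- 2 * \<beta>)\<close> for large \<open>\<beta>\<close>. The minimum is handled by
  reflecting \<open>{1..n}\<close>.

  Lower bound. Permuting the ends of the open paths does not change the weight, so closing at
  \<open>k + 1\<close> has probability at most \<open>E (1 / (flux k \<sigma>)\<^sup>2)\<close> on the event that the cut is crossed
  (\<open>prob_closes_le\<close>). Creating crossings by exchanges shows that the flux is rarely smaller than
  order \<open>W\<close>, where \<open>W\<close> is of order \<open>min (1 / \<beta>) n\<close> (\<open>inverse_second_moment_flux\<close>); and an
  exchange of \<open>s\<close> with the exit of any open path makes the cycle of \<open>s\<close> cross the cut at \<open>s + W\<close> with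
  probability bounded below (\<open>prob_crosses_ge\<close>). Since each of the next steps closes the cycle with
  probability \<open>O(1 / W\<^sup>2)\<close>, a union bound keeps it open for a small multiple of \<open>min (W\<^sup>2) n\<close> steps.
  When \<open>1 / \<beta>\<close> or \<open>n\<close> is bounded, the probability of \<open>\<sigma> s \<noteq> s\<close> alone suffices.
\<close>

section \<open>The part of a permutation below a cut\<close>

text \<open>
  Exchanging the images of two points leaves this relation unchanged if both points lie beyond the cut,
  or if both are sent beyond it. The flux, the exit and entry points, and whether the cycle of \<open>s\<close>
  crosses the cut depend on this relation alone, so all of them survive such an exchange.
\<close>

definition below :: "nat \<Rightarrow> (nat \<Rightarrow> nat) \<Rightarrow> nat rel" where
  "below k \<sigma> = {(x, y). x \<le> k \<and> y \<le> k \<and> y = \<sigma> x}"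

definition crosses :: "nat \<Rightarrow> (nat \<Rightarrow> nat) \<Rightarrow> nat \<Rightarrow> bool" where
  "crosses k \<sigma> s \<longleftrightarrow> (\<exists>x\<in>orbit \<sigma> s. k < x)"

definition outs :: "nat \<Rightarrow> (nat \<Rightarrow> nat) \<Rightarrow> nat set" where
  "outs k \<sigma> = {j. j \<le> k \<and> k < \<sigma> j}"

definition flux :: "nat \<Rightarrow> (nat \<Rightarrow> nat) \<Rightarrow> nat" where
  "flux k \<sigma> = card (outs k \<sigma>)"

text \<open>
  The end of the path of \<open>s\<close> in the relation \<open>G\<close>; meaningful only if that path ends, that is, if the
  cycle of \<open>s\<close> crosses the cut. Applied to the converse relation it gives the beginning of the path.
\<close>

definition exit_point :: "nat rel \<Rightarrow> nat \<Rightarrow> nat" where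
  "exit_point G s = (SOME t. (s, t) \<in> G\<^sup>* \<and> t \<notin> Domain G)"

abbreviation entry_point :: "nat rel \<Rightarrow> nat \<Rightarrow> nat" where
  "entry_point G s \<equiv> exit_point (G\<inverse>) s"

lemma below_reach_le: "(s, t) \<in> (below k \<sigma>)\<^sup>* \<Longrightarrow> s \<le> k \<Longrightarrow> t \<le> k"
  by (induction rule: rtrancl_induct) (auto simp: below_def)

lemma below_reach_orbit: "(s, t) \<in> (below k \<sigma>)\<^sup>* \<Longrightarrow> \<sigma> t \<in> orbit \<sigma> s"
  by (induction rule: rtrancl_induct) (auto simp: below_def intro: orbit.intros)

lemma single_valued_below: "single_valued (below k \<sigma>)"
  by (auto simp: single_valued_def below_def)

lemma notin_Domain_below: "t \<le> k \<Longrightarrow> t \<notin> Domain (below k \<sigma>) \<longleftrightarrow> k < \<sigma> t"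
  by (auto simp: below_def Domain_iff)

lemma below_inv: "bij \<sigma> \<Longrightarrow> below k (inv \<sigma>) = (below k \<sigma>)\<inverse>"
  by (auto simp: below_def bij_inv_eq_iff inv_f_f bij_is_inj)

lemma finite_outs: "finite (outs k \<sigma>)"
  by (rule finite_subset[of _ "{..k}"]) (auto simp: outs_def)

lemma outs_eq_below: "outs k \<sigma> = {..k} - Domain (below k \<sigma>)"
  by (auto simp: outs_def notin_Domain_below below_def Domain_iff)

lemma flux_cong_below: "below k \<sigma> = below k \<tau> \<Longrightarrow> flux k \<sigma> = flux k \<tau>"
  by (simp add: flux_def outs_eq_below)

text \<open>
  If no point reachable from \<open>s\<close> below the cut were an exit, then the reachable points would be closed
  under \<open>\<sigma>\<close> and would contain the whole cycle.
\<close>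

lemma crosses_iff_exit:
  assumes "s \<le> k"
  shows "crosses k \<sigma> s \<longleftrightarrow> (\<exists>t. (s, t) \<in> (below k \<sigma>)\<^sup>* \<and> t \<notin> Domain (below k \<sigma>))"
proof
  assume cr: "crosses k \<sigma> s"
  show "\<exists>t. (s, t) \<in> (below k \<sigma>)\<^sup>* \<and> t \<notin> Domain (below k \<sigma>)"
  proof (rule ccontr)
    assume "\<nexists>t. (s, t) \<in> (below k \<sigma>)\<^sup>* \<and> t \<notin> Domain (below k \<sigma>)"
    then have dom: "t \<in> Domain (below k \<sigma>)" if "(s, t) \<in> (below k \<sigma>)\<^sup>*" for t
      using that by blast
    have step: "(s, \<sigma> t) \<in> (below k \<sigma>)\<^sup>*" if "(s, t) \<in> (below k \<sigma>)\<^sup>*" for t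
    proof -
      have "(t, \<sigma> t) \<in> below k \<sigma>"
        using dom[OF that] by (auto simp: below_def)
      with that show ?thesis by simp
    qed
    have "(s, x) \<in> (below k \<sigma>)\<^sup>*" if "x \<in> orbit \<sigma> s" for x
      using that by induction (auto intro: step)
    then have "x \<le> k" if "x \<in> orbit \<sigma> s" for x
      using that below_reach_le[OF _ assms] by blast
    with cr show False
      by (force simp: crosses_def)
  qed
next
  assume "\<exists>t. (s, t) \<in> (below k \<sigma>)\<^sup>* \<and> t \<notin> Domain (below k \<sigma>)"
  then obtain t where t: "(s, t) \<in> (below k \<sigma>)\<^sup>*" "t \<notin> Domain (below k \<sigma>)" by blast
  then have "k < \<sigma> t"
    using below_reach_le[OF t(1) assms] notin_Domain_below by blast
  with below_reach_orbit[OF t(1)] show "crosses k \<sigma> s"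
    by (auto simp: crosses_def)
qed

lemma crosses_cong_below: "s \<le> k \<Longrightarrow> below k \<sigma> = below k \<tau> \<Longrightarrow> crosses k \<sigma> s \<longleftrightarrow> crosses k \<tau> s"
  by (simp add: crosses_iff_exit)

lemma exit_point:
  assumes "s \<le> k" "crosses k \<sigma> s"
  defines "t \<equiv> exit_point (below k \<sigma>) s"
  shows "(s, t) \<in> (below k \<sigma>)\<^sup>*" "t \<le> k" "k < \<sigma> t" "t \<in> outs k \<sigma>"
proof -
  have *: "(s, t) \<in> (below k \<sigma>)\<^sup>* \<and> t \<notin> Domain (below k \<sigma>)"
    unfolding t_def exit_point_def
    using assms(2) unfolding crosses_iff_exit[OF assms(1)] by (rule someI_ex)
  then show r: "(s, t) \<in> (below k \<sigma>)\<^sup>*" and le: "t \<le> k"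
    using below_reach_le[OF _ assms(1)] by auto
  with * show "k < \<sigma> t" by (auto simp: notin_Domain_below)
  with le show "t \<in> outs k \<sigma>" by (simp add: outs_def)
qed

lemma crosses_inv:
  assumes "\<sigma> permutes {1..n}"
  shows "crosses k (inv \<sigma>) s \<longleftrightarrow> crosses k \<sigma> s"
proof -
  have "permutation \<sigma>"
    using assms by (meson finite_atLeastAtMost permutation_permutes)
  then show ?thesis by (simp add: crosses_def orbit_inv_eq)
qed

lemma entry_point:
  assumes "\<sigma> permutes {1..n}" "s \<le> k" "crosses k \<sigma> s"
  defines "v \<equiv> entry_point (below k \<sigma>) s"
  shows "(v, s) \<in> (below k \<sigma>)\<^sup>*" "v \<le> k" "k < inv \<sigma> v"
proof -
  have b: "below k (inv \<sigma>) = (below k \<sigma>)\<inverse>"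
    using assms(1) by (intro below_inv permutes_bij)
  have c: "crosses k (inv \<sigma>) s"
    using assms by (simp add: crosses_inv)
  note * = exit_point[OF assms(2) c, unfolded b, folded v_def]
  from * show "(v, s) \<in> (below k \<sigma>)\<^sup>*" "v \<le> k" "k < inv \<sigma> v"
    by (auto simp: rtrancl_converse)
qed

text \<open>
  The path of \<open>s\<close> from its entry to its exit, together with \<open>Suc k\<close>, is closed under \<open>\<sigma>\<close> exactly when
  the two edges at \<open>Suc k\<close> join the two ends of that path.
\<close>

lemma crosses_Suc_iff:
  assumes \<sigma>: "\<sigma> permutes {1..n}" and s: "s \<le> k" and cr: "crosses k \<sigma> s"
  defines "t \<equiv> exit_point (below k \<sigma>) s" and "v \<equiv> entry_point (below k \<sigma>) s"
  shows "\<not> crosses (Suc k) \<sigma> s \<longleftrightarrow> \<sigma> t = Suc k \<and> \<sigma> (Suc k) = v"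
proof
  note t = exit_point[OF s cr, folded t_def]
  note v = entry_point[OF \<sigma> s cr, folded v_def]
  have perm: "permutation \<sigma>"
    using \<sigma> by (meson finite_atLeastAtMost permutation_permutes)
  {
    assume nc: "\<not> crosses (Suc k) \<sigma> s"
    then have le: "x \<le> Suc k" if "x \<in> orbit \<sigma> s" for x
      using that by (force simp: crosses_def)
    have "\<sigma> t = Suc k"
      using le[OF below_reach_orbit[OF t(1)]] t(3) by simp
    moreover have "inv \<sigma> v \<in> orbit (inv \<sigma>) s"
    proof -
      have "(s, v) \<in> (below k (inv \<sigma>))\<^sup>*"
        using v(1) \<sigma> by (simp add: below_inv permutes_bij rtrancl_converse)
      then show ?thesis by (rule below_reach_orbit)
    qed
    then have "inv \<sigma> v = Suc k"
      using le[of "inv \<sigma> v"] v(3) by (simp add: orbit_inv_eq[OF perm])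
    then have "\<sigma> (Suc k) = v"
      using permutes_inverses(1)[OF \<sigma>, of v] by simp
    ultimately show "\<sigma> t = Suc k \<and> \<sigma> (Suc k) = v" by simp
  next
    assume *: "\<sigma> t = Suc k \<and> \<sigma> (Suc k) = v"
    let ?G = "below k \<sigma>"
    have vt: "(v, t) \<in> ?G\<^sup>*"
      using v(1) t(1) by simp
    have tD: "t \<notin> Domain ?G"
      using t(2,3) by (simp add: notin_Domain_below)
    have step: "\<sigma> x = Suc k \<or> (v, \<sigma> x) \<in> ?G\<^sup>*" if x: "(v, x) \<in> ?G\<^sup>*" for x
    proof (cases "x \<in> Domain ?G")
      case True
      then have "(x, \<sigma> x) \<in> ?G" by (auto simp: below_def)
      with x show ?thesis by (meson rtrancl.rtrancl_into_rtrancl)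
    next
      case False
      have "(x, t) \<in> ?G\<^sup>* \<or> (t, x) \<in> ?G\<^sup>*"
        by (rule single_valued_confluent[OF single_valued_below x vt])
      then have "x = t"
        using False tD by (metis Domain.DomainI converse_rtranclE)
      with * show ?thesis by simp
    qed
    have "x = Suc k \<or> (v, x) \<in> ?G\<^sup>*" if "x \<in> orbit \<sigma> s" for x
      using that
    proof induction
      case base
      show ?case by (rule step[OF v(1)])
    next
      case (step x)
      then show ?case
        using * \<open>\<And>x. (v, x) \<in> ?G\<^sup>* \<Longrightarrow> \<sigma> x = Suc k \<or> (v, \<sigma> x) \<in> ?G\<^sup>*\<close> by auto
    qed
    then have "x \<le> Suc k" if "x \<in> orbit \<sigma> s" for x
      using that below_reach_le[OF _ v(2)] by fastforce
    then show "\<not> crosses (Suc k) \<sigma> s"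
      by (force simp: crosses_def)
  }
qed

text \<open>
  The name \<open>transpose\<close> by itself denotes the transposition of matrices here.
\<close>

abbreviation transp :: "nat \<Rightarrow> nat \<Rightarrow> nat \<Rightarrow> nat" where
  "transp \<equiv> Transposition.transpose"

lemma below_swap:
  assumes "k < i \<or> k < \<sigma> i" "k < i \<or> k < \<sigma> j" "k < j \<or> k < \<sigma> i" "k < j \<or> k < \<sigma> j"
  shows "below k (\<sigma> \<circ> transp i j) = below k \<sigma>"
  using assms by (auto simp: below_def Transposition.transpose_def)

lemma finite_sources:
  fixes \<sigma> :: "nat \<Rightarrow> nat"
  assumes "\<sigma> permutes {1..n}" 
  shows "finite {j. k < j \<and> \<sigma> j \<le> k}"
proof -
  have "{j. k < j \<and> \<sigma> j \<le> k} \<subseteq> {1..n}"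
  proof
    fix j assume "j \<in> {j. k < j \<and> \<sigma> j \<le> k}"
    then show "j \<in> {1..n}"
      using permutes_not_in[OF assms, of j] by (cases "j \<in> {1..n}") auto
  qed
  then show ?thesis
    using finite_subset by blast
qed

text \<open>
  A bijection sends as many points rightwards over the cut as leftwards.
\<close>

lemma card_sources:
  assumes \<sigma>: "\<sigma> permutes {1..n}"
  shows "card {j. k < j \<and> \<sigma> j \<le> k} = flux k \<sigma>"
proof -
  let ?A = "{j. j \<le> k \<and> \<sigma> j \<le> k}" and ?S = "{j. k < j \<and> \<sigma> j \<le> k}"
  have fA: "finite ?A" by (rule finite_subset[of _ "{..k}"]) auto
  have "card (?A \<union> ?S) = card {..k}"
  proof (rule bij_betw_same_card[of \<sigma>])
    have "bij \<sigma>" using \<sigma> by (rule permutes_bij)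
    moreover have "\<sigma> ` (?A \<union> ?S) = {..k}"
    proof (intro equalityI subsetI)
      fix y assume "y \<in> {..k}"
      then have "inv \<sigma> y \<in> ?A \<union> ?S" "\<sigma> (inv \<sigma> y) = y"
        using permutes_inverses(1)[OF \<sigma>] by auto
      then show "y \<in> \<sigma> ` (?A \<union> ?S)" by (metis imageI)
    qed auto
    ultimately show "bij_betw \<sigma> (?A \<union> ?S) {..k}"
      by (auto simp: bij_betw_def bij_def intro: inj_on_subset)
  qed
  moreover have "card (?A \<union> ?S) = card ?A + card ?S"
    using fA finite_sources[OF \<sigma>] by (intro card_Un_disjoint) auto
  moreover have "card {..k} = card ?A + flux k \<sigma>"
  proof -
    have "{..k} = ?A \<union> outs k \<sigma>" by (auto simp: outs_def)
    then show ?thesis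
      unfolding flux_def using fA finite_outs by (subst card_Un_disjoint[symmetric]) (auto simp: outs_def)
  qed
  ultimately show ?thesis by simp
qed

section \<open>Exchanging two images\<close>

text \<open>
  The decrease of the \<open>L\<^sup>1\<close> distance to the identity when the images of \<open>i\<close> and \<open>j\<close> are exchanged.
\<close>

definition gain :: "(nat \<Rightarrow> nat) \<Rightarrow> nat \<Rightarrow> nat \<Rightarrow> real" where
  "gain \<sigma> i j = \<bar>real (\<sigma> i) - real i\<bar> + \<bar>real (\<sigma> j) - real j\<bar>
     - \<bar>real (\<sigma> j) - real i\<bar> - \<bar>real (\<sigma> i) - real j\<bar>"

lemma L1_dist_swap:
  assumes "i \<in> {1..n}" "j \<in> {1..n}"
  shows "L1_dist n (\<sigma> \<circ> transp i j) id = L1_dist n \<sigma> id - gain \<sigma> i j"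
proof (cases "i = j")
  case True
  then show ?thesis by (simp add: gain_def)
next
  case False
  let ?d = "\<lambda>\<tau> m. \<bar>real (\<tau> m) - real (id m)\<bar>"
  have split: "L1_dist n \<tau> id = ?d \<tau> i + (?d \<tau> j + sum (?d \<tau>) ({1..n} - {i} - {j}))" for \<tau>
    unfolding L1_dist_def using assms False
    by (subst sum.remove[of _ i], simp, simp) (subst sum.remove[of _ j], auto)
  have "sum (?d (\<sigma> \<circ> transp i j)) ({1..n} - {i} - {j}) = sum (?d \<sigma>) ({1..n} - {i} - {j})"
    by (rule sum.cong) (auto simp: Transposition.transpose_def)
  then show ?thesis
    unfolding split gain_def using False by simp
qed

locale mallows =
  fixes n :: nat and \<beta> :: real
  assumes \<beta>_pos: "\<beta> > 0"
begin

abbreviation perms :: "(nat \<Rightarrow> nat) set" where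
  "perms \<equiv> {\<sigma>. \<sigma> permutes {1..n}}"

abbreviation pr :: "(nat \<Rightarrow> nat) \<Rightarrow> real" where
  "pr \<equiv> pmf (mallows_pmf n \<beta>)"

abbreviation E :: "((nat \<Rightarrow> nat) \<Rightarrow> real) \<Rightarrow> real" where
  "E \<equiv> measure_pmf.expectation (mallows_pmf n \<beta>)"

lemma E_sum: "E f = (\<Sum>\<sigma>\<in>perms. pr \<sigma> * f \<sigma>)"
  by (subst integral_measure_pmf_real[of perms])
    (auto simp: finite_permutations set_pmf_mallows mult.commute)

lemma integrable_E: "integrable (mallows_pmf n \<beta>) f" for f :: "_ \<Rightarrow> real"
  by (rule integrable_measure_pmf_finite) (simp add: set_pmf_mallows finite_permutations)

lemma E_mono: "(\<And>\<sigma>. \<sigma> permutes {1..n} \<Longrightarrow> f \<sigma> \<le> g \<sigma>) \<Longrightarrow> E f \<le> E g"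
  unfolding E_sum by (intro sum_mono mult_left_mono) auto

lemma E_cong: "(\<And>\<sigma>. \<sigma> permutes {1..n} \<Longrightarrow> f \<sigma> = g \<sigma>) \<Longrightarrow> E f = E g"
  unfolding E_sum by (intro sum.cong) auto

lemma E_nonneg: "(\<And>\<sigma>. \<sigma> permutes {1..n} \<Longrightarrow> 0 \<le> f \<sigma>) \<Longrightarrow> 0 \<le> E f"
  using E_mono[of "\<lambda>_. 0" f] by simp

lemma E_const: "E (\<lambda>_. c) = c"
  by simp

lemma E_add: "E (\<lambda>\<sigma>. f \<sigma> + g \<sigma>) = E f + E g"
  by (simp add: E_sum distrib_left sum.distrib)

lemma E_cmult: "E (\<lambda>\<sigma>. c * f \<sigma>) = c * E f"
  by (simp add: E_sum sum_distrib_left mult_ac)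

lemma pr_swap:
  assumes "\<sigma> permutes {1..n}" "i \<in> {1..n}" "j \<in> {1..n}"
  shows "pr \<sigma> = pr (\<sigma> \<circ> transp i j) * exp (- \<beta> * gain \<sigma> i j)"
proof -
  have "(\<sigma> \<circ> transp i j) permutes {1..n}"
    using assms by (intro permutes_compose permutes_swap_id) auto
  then show ?thesis
    using assms by (simp add: pmf_mallows L1_dist_swap algebra_simps flip: exp_add)
qed

text \<open>
  The transport principle behind all estimates. \<open>Q \<sigma>\<close> is the set of exchanges performed on \<open>\<sigma>\<close>, and
  \<open>R \<tau>\<close> contains every pair whose exchange may have produced \<open>\<tau>\<close>. As exchanging twice restores the
  permutation, a triple \<open>(\<sigma>, i, j)\<close> is recovered from \<open>(\<tau>, i, j)\<close>, so that nothing is counted twice.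
\<close>

lemma exchange_bound:
  fixes f h :: "(nat \<Rightarrow> nat) \<Rightarrow> real" and g :: "(nat \<Rightarrow> nat) \<Rightarrow> nat \<Rightarrow> nat \<Rightarrow> real"
  assumes Q: "\<And>\<sigma>. \<sigma> permutes {1..n} \<Longrightarrow> Q \<sigma> \<subseteq> {1..n} \<times> {1..n}"
    and R: "\<And>\<sigma>. \<sigma> permutes {1..n} \<Longrightarrow> R \<sigma> \<subseteq> {1..n} \<times> {1..n}"
    and g: "\<And>\<sigma> i j. \<sigma> permutes {1..n} \<Longrightarrow> (i, j) \<in> R \<sigma> \<Longrightarrow> 0 \<le> g \<sigma> i j"
    and swap: "\<And>\<sigma> i j. \<sigma> permutes {1..n} \<Longrightarrow> (i, j) \<in> Q \<sigma> \<Longrightarrow> (i, j) \<in> R (\<sigma> \<circ> transp i j)"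
    and cost: "\<And>\<sigma> i j. \<sigma> permutes {1..n} \<Longrightarrow> (i, j) \<in> Q \<sigma> \<Longrightarrow>
      exp (- \<beta> * gain \<sigma> i j) * f \<sigma> \<le> g (\<sigma> \<circ> transp i j) i j"
    and h: "\<And>\<sigma>. \<sigma> permutes {1..n} \<Longrightarrow> (\<Sum>(i, j)\<in>R \<sigma>. g \<sigma> i j) \<le> h \<sigma>"
  shows "E (\<lambda>\<sigma>. f \<sigma> * card (Q \<sigma>)) \<le> E h"
proof -
  have fQ: "finite (Q \<sigma>)" and fR: "finite (R \<sigma>)" if "\<sigma> permutes {1..n}" for \<sigma>
    using Q[OF that] R[OF that] finite_subset[OF _ finite_cartesian_product] by blast+
  have perm: "(\<sigma> \<circ> transp i j) permutes {1..n}"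
    if "\<sigma> permutes {1..n}" "i \<in> {1..n}" "j \<in> {1..n}" for \<sigma> i j
    using that by (intro permutes_compose permutes_swap_id) auto
  have "E (\<lambda>\<sigma>. f \<sigma> * card (Q \<sigma>)) = (\<Sum>\<sigma>\<in>perms. \<Sum>ij\<in>Q \<sigma>. pr \<sigma> * f \<sigma>)"
    by (simp add: E_sum mult_ac)
  also have "\<dots> = (\<Sum>(\<sigma>, ij)\<in>Sigma perms Q. pr \<sigma> * f \<sigma>)"
    using finite_perms fQ by (subst sum.Sigma) auto
  also have "\<dots> \<le> (\<Sum>(\<sigma>, ij)\<in>Sigma perms R. pr \<sigma> * (case ij of (i, j) \<Rightarrow> g \<sigma> i j))"
  proof (rule sum_le_included[where i = "\<lambda>(\<sigma>, (i, j)). (\<sigma> \<circ> transp i j, (i, j))"])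
    show "finite (Sigma perms Q)" "finite (Sigma perms R)"
      using finite_perms fQ fR by (auto intro: finite_SigmaI)
    show "\<forall>y\<in>Sigma perms R. 0 \<le> (case y of (\<sigma>, ij) \<Rightarrow> pr \<sigma> * (case ij of (i, j) \<Rightarrow> g \<sigma> i j))"
      using g by auto
    show "\<forall>x\<in>Sigma perms Q. \<exists>y\<in>Sigma perms R.
        (case y of (\<sigma>, (i, j)) \<Rightarrow> (\<sigma> \<circ> transp i j, (i, j))) = x \<and>
        (case x of (\<sigma>, ij) \<Rightarrow> pr \<sigma> * f \<sigma>)
          \<le> (case y of (\<sigma>, ij) \<Rightarrow> pr \<sigma> * (case ij of (i, j) \<Rightarrow> g \<sigma> i j))"
    proof (clarify)
      fix \<sigma> i j assume \<sigma>: "\<sigma> permutes {1..n}" and ij: "(i, j) \<in> Q \<sigma>"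
      have I: "i \<in> {1..n}" "j \<in> {1..n}" using Q[OF \<sigma>] ij by auto
      let ?\<tau> = "\<sigma> \<circ> transp i j"
      have "pr \<sigma> * f \<sigma> = pr ?\<tau> * (exp (- \<beta> * gain \<sigma> i j) * f \<sigma>)"
        by (subst pr_swap[OF \<sigma> I]) simp
      also have "\<dots> \<le> pr ?\<tau> * g ?\<tau> i j"
        by (rule mult_left_mono[OF cost[OF \<sigma> ij]]) simp
      finally have "pr \<sigma> * f \<sigma> \<le> pr ?\<tau> * g ?\<tau> i j" .
      moreover have "?\<tau> \<circ> transp i j = \<sigma>"
        by (simp add: comp_assoc)
      ultimately show "\<exists>y\<in>Sigma perms R.
        (case y of (\<sigma>, (i, j)) \<Rightarrow> (\<sigma> \<circ> transp i j, (i, j))) = (\<sigma>, (i, j)) \<and>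
        pr \<sigma> * f \<sigma> \<le> (case y of (\<sigma>, ij) \<Rightarrow> pr \<sigma> * (case ij of (i, j) \<Rightarrow> g \<sigma> i j))"
        using swap[OF \<sigma> ij] perm[OF \<sigma> I] by (intro bexI[of _ "(?\<tau>, (i, j))"]) auto
    qed
  qed
  also have "\<dots> = E (\<lambda>\<sigma>. \<Sum>(i, j)\<in>R \<sigma>. g \<sigma> i j)"
    unfolding E_sum sum_distrib_left using finite_perms fR by (subst sum.Sigma) auto
  also have "\<dots> \<le> E h"
    using h by (rule E_mono)
  finally show ?thesis .
qed


section \<open>Geometric sums\<close>

definition q :: real where "q = exp (- 2 * \<beta>)"

definition K :: real where "K = 1 / (1 - q)"

lemma q_bounds: "0 < q" "q < 1"
  using \<beta>_pos by (auto simp: q_def)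

lemma q_pow_nonneg: "0 \<le> q ^ m"
  using q_bounds by simp

lemma q_pow_le_one: "q ^ m \<le> 1"
  using q_bounds by (simp add: power_le_one)

lemma K_ge_1: "1 \<le> K"
  using q_bounds by (simp add: K_def field_simps)

lemma exp_minus_gain:
  assumes "gain \<sigma> i j = 2 * real m"
  shows "exp (- \<beta> * gain \<sigma> i j) = q ^ m"
  unfolding assms q_def by (simp add: exp_of_nat_mult[symmetric] mult_ac)

text \<open>
  If the interval from \<open>i\<close> to \<open>\<sigma> i\<close> is traversed rightwards and the one from \<open>\<sigma> j\<close> to \<open>j\<close> leftwards,
  then the exchange removes their overlap, of length \<open>m\<close>, from both.
\<close>

lemma gain_uncross:
  assumes "max i (\<sigma> j) + m = min j (\<sigma> i)"
  shows "gain \<sigma> i j = 2 * real m"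
proof -
  have "gain \<sigma> i j = 2 * (min (real j) (real (\<sigma> i)) - max (real i) (real (\<sigma> j)))"
  proof -
    have "i \<le> j" "i \<le> \<sigma> i" "\<sigma> j \<le> j" "\<sigma> j \<le> \<sigma> i" using assms by linarith+
    then show ?thesis
      unfolding gain_def by (simp add: abs_if min_def max_def)
  qed
  moreover have "max (real i) (real (\<sigma> j)) + real m = min (real j) (real (\<sigma> i))"
    by (metis assms of_nat_add of_nat_max of_nat_min)
  ultimately show ?thesis by simp
qed

text \<open>
  Distances of distinct points to a cut are distinct, so the sums over exchanges are dominated by the
  geometric series.
\<close>

lemma sum_q_pow_inj_le:
  assumes "finite A" "inj_on h A"
  shows "(\<Sum>a\<in>A. q ^ h a) \<le> K"
proof -
  have "(\<Sum>a\<in>A. q ^ h a) = (\<Sum>m\<in>h ` A. q ^ m)"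
    using assms(2) by (simp add: sum.reindex)
  also have "\<dots> \<le> (\<Sum>m. q ^ m)"
    using assms(1) q_bounds by (intro sum_le_suminf) (auto intro: summable_geometric)
  also have "\<dots> = K"
    using q_bounds by (simp add: suminf_geometric K_def)
  finally show ?thesis .
qed

lemma sum_q_pow_min_le:
  assumes "finite A" "inj_on h A" "inj_on h' A"
  shows "(\<Sum>a\<in>A. q ^ min (h a) (h' a)) \<le> 2 * K"
proof -
  have "(\<Sum>a\<in>A. q ^ min (h a) (h' a)) \<le> (\<Sum>a\<in>A. q ^ h a + q ^ h' a)"
    by (intro sum_mono) (auto simp: min_def q_pow_nonneg)
  also have "\<dots> \<le> 2 * K"
    using sum_q_pow_inj_le[OF assms(1,2)] sum_q_pow_inj_le[OF assms(1,3)]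
    by (simp add: sum.distrib)
  finally show ?thesis .
qed

lemma sum_right_le:
  assumes "\<sigma> permutes {1..n}"
  shows "(\<Sum>x | x \<in> {1..n} \<and> k < x \<and> k < \<sigma> x. q ^ (min x (\<sigma> x) - Suc k)) \<le> 2 * K"
proof -
  let ?A = "{x. x \<in> {1..n} \<and> k < x \<and> k < \<sigma> x}"
  have inj: "inj \<sigma>" using assms by (rule permutes_inj)
  have "(\<Sum>x\<in>?A. q ^ (min x (\<sigma> x) - Suc k)) = (\<Sum>x\<in>?A. q ^ min (x - Suc k) (\<sigma> x - Suc k))"
    by (intro sum.cong refl arg_cong[of _ _ "\<lambda>m. q ^ m"]) auto
  also have "\<dots> \<le> 2 * K"
  proof (rule sum_q_pow_min_le)
    show "inj_on (\<lambda>x. x - Suc k) ?A"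
      by (auto intro!: inj_onI)
    show "inj_on (\<lambda>x. \<sigma> x - Suc k) ?A"
    proof (rule inj_onI)
      fix x y assume "x \<in> ?A" "y \<in> ?A" "\<sigma> x - Suc k = \<sigma> y - Suc k"
      then have "\<sigma> x = \<sigma> y" by auto
      then show "x = y" using inj by (simp add: inj_eq)
    qed
  qed simp
  finally show ?thesis .
qed

lemma sum_left_le:
  assumes "\<sigma> permutes {1..n}"
  shows "(\<Sum>x | x \<in> {1..n} \<and> x \<le> k \<and> \<sigma> x \<le> k. q ^ (k - max x (\<sigma> x))) \<le> 2 * K"
proof -
  let ?A = "{x. x \<in> {1..n} \<and> x \<le> k \<and> \<sigma> x \<le> k}"
  have inj: "inj \<sigma>" using assms by (rule permutes_inj)
  have "(\<Sum>x\<in>?A. q ^ (k - max x (\<sigma> x))) = (\<Sum>x\<in>?A. q ^ min (k - x) (k - \<sigma> x))"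
    by (intro sum.cong refl arg_cong[of _ _ "\<lambda>m. q ^ m"]) auto
  also have "\<dots> \<le> 2 * K"
  proof (rule sum_q_pow_min_le)
    show "inj_on (\<lambda>x. k - x) ?A"
      by (auto intro!: inj_onI)
    show "inj_on (\<lambda>x. k - \<sigma> x) ?A"
    proof (rule inj_onI)
      fix x y assume "x \<in> ?A" "y \<in> ?A" "k - \<sigma> x = k - \<sigma> y"
      then have "\<sigma> x = \<sigma> y" by auto
      then show "x = y" using inj by (simp add: inj_eq)
    qed
  qed simp
  finally show ?thesis .
qed

lemma outs_subset: "\<sigma> permutes {1..n} \<Longrightarrow> outs k \<sigma> \<subseteq> {1..n}"
proof
  fix j assume "\<sigma> permutes {1..n}" "j \<in> outs k \<sigma>"
  then show "j \<in> {1..n}"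
    using permutes_not_in[of \<sigma> "{1..n}" j] by (cases "j \<in> {1..n}") (auto simp: outs_def)
qed

lemma sources_subset: "\<sigma> permutes {1..n} \<Longrightarrow> {j. k < j \<and> \<sigma> j \<le> k} \<subseteq> {1..n}"
proof
  fix j assume "\<sigma> permutes {1..n}" "j \<in> {j. k < j \<and> \<sigma> j \<le> k}"
  then show "j \<in> {1..n}"
    using permutes_not_in[of \<sigma> "{1..n}" j] by (cases "j \<in> {1..n}") auto
qed

section \<open>Upper bound for the flux\<close>

text \<open>
  An edge \<open>i \<mapsto> \<sigma> i\<close> over the cut to the right and an edge \<open>j \<mapsto> \<sigma> j\<close> over it to the left are replaced
  by \<open>i \<mapsto> \<sigma> j\<close> and \<open>j \<mapsto> \<sigma> i\<close>, which stay on their sides. The gain is twice the overlap of the two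
  edges, which splits into a part left and a part right of the cut; summing each part over the possible
  positions gives a factor \<open>2 * K\<close>, and the cut itself contributes the factor \<open>q\<close>. The predicate
  \<open>good\<close> is a property that survives these exchanges.
\<close>

lemma uncross:
  fixes good :: "(nat \<Rightarrow> nat) \<Rightarrow> bool" and I :: "(nat \<Rightarrow> nat) \<Rightarrow> nat set"
  assumes I: "\<And>\<sigma>. \<sigma> permutes {1..n} \<Longrightarrow> I \<sigma> \<subseteq> outs k \<sigma>"
    and good: "\<And>\<sigma> i j. \<lbrakk>\<sigma> permutes {1..n}; good \<sigma>; i \<in> I \<sigma>; k < j; \<sigma> j \<le> k\<rbrakk> \<Longrightarrow>
      good (\<sigma> \<circ> transp i j)"
  shows "E (\<lambda>\<sigma>. of_bool (good \<sigma>) * (real (card (I \<sigma>)) * real (flux k \<sigma>)))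
    \<le> 4 * q * K\<^sup>2 * E (\<lambda>\<sigma>. of_bool (good \<sigma>))"
proof -
  define Q where "Q \<sigma> = (if good \<sigma> then I \<sigma> \<times> {j. k < j \<and> \<sigma> j \<le> k} else {})" for \<sigma>
  define A where "A \<sigma> = {x. x \<in> {1..n} \<and> x \<le> k \<and> \<sigma> x \<le> k}" for \<sigma> :: "nat \<Rightarrow> nat"
  define B where "B \<sigma> = {x. x \<in> {1..n} \<and> k < x \<and> k < \<sigma> x}" for \<sigma> :: "nat \<Rightarrow> nat"
  define g where "g \<sigma> i j = of_bool (good \<sigma>) * (q ^ (k - max i (\<sigma> i)) * (q * q ^ (min j (\<sigma> j) - Suc k)))"
    for \<sigma> :: "nat \<Rightarrow> nat" and i j
  have "E (\<lambda>\<sigma>. of_bool (good \<sigma>) * real (card (Q \<sigma>))) \<le> E (\<lambda>\<sigma>. 4 * q * K\<^sup>2 * of_bool (good \<sigma>))"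
  proof (rule exchange_bound[where R = "\<lambda>\<sigma>. A \<sigma> \<times> B \<sigma>" and g = g])
    fix \<sigma> assume \<sigma>: "\<sigma> permutes {1..n}"
    show "Q \<sigma> \<subseteq> {1..n} \<times> {1..n}"
      unfolding Q_def using Sigma_mono[OF subset_trans[OF I[OF \<sigma>] outs_subset[OF \<sigma>]] sources_subset[OF \<sigma>]]
      by simp
    show "A \<sigma> \<times> B \<sigma> \<subseteq> {1..n} \<times> {1..n}"
      by (auto simp: A_def B_def)
    show "(\<Sum>(i, j)\<in>A \<sigma> \<times> B \<sigma>. g \<sigma> i j) \<le> 4 * q * K\<^sup>2 * of_bool (good \<sigma>)"
    proof -
      have "(\<Sum>(i, j)\<in>A \<sigma> \<times> B \<sigma>. g \<sigma> i j) = of_bool (good \<sigma>) * q *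
          ((\<Sum>i\<in>A \<sigma>. q ^ (k - max i (\<sigma> i))) * (\<Sum>j\<in>B \<sigma>. q ^ (min j (\<sigma> j) - Suc k)))"
        unfolding sum_product g_def
        by (simp add: sum.cartesian_product[symmetric] sum_distrib_left mult_ac)
      also have "\<dots> \<le> of_bool (good \<sigma>) * q * ((2 * K) * (2 * K))"
        using sum_left_le[OF \<sigma>, of k] sum_right_le[OF \<sigma>, of k] q_bounds K_ge_1
        unfolding A_def B_def by (intro mult_left_mono mult_mono) (auto intro!: sum_nonneg)
      also have "\<dots> = 4 * q * K\<^sup>2 * of_bool (good \<sigma>)"
        by (simp add: power2_eq_square)
      finally show ?thesis .
    qed
  next
    fix \<sigma> i j assume \<sigma>: "\<sigma> permutes {1..n}" and ij: "(i, j) \<in> A \<sigma> \<times> B \<sigma>"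
    show "0 \<le> g \<sigma> i j"
      using q_bounds by (simp add: g_def)
  next
    fix \<sigma> i j assume \<sigma>: "\<sigma> permutes {1..n}" and ij: "(i, j) \<in> Q \<sigma>"
    then have gd: "good \<sigma>" and iI: "i \<in> I \<sigma>" and j: "k < j" "\<sigma> j \<le> k"
      by (auto simp: Q_def split: if_splits)
    have i: "i \<le> k" "k < \<sigma> i" using I[OF \<sigma>] iI by (auto simp: outs_def)
    let ?\<tau> = "\<sigma> \<circ> transp i j"
    have \<tau>: "?\<tau> i = \<sigma> j" "?\<tau> j = \<sigma> i" by auto
    have "i \<in> {1..n}" "j \<in> {1..n}"
      using subsetD[OF subset_trans[OF I[OF \<sigma>] outs_subset[OF \<sigma>]] iI]
        subsetD[OF sources_subset[OF \<sigma>, of k], of j] j by simp_all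
    then show "(i, j) \<in> A ?\<tau> \<times> B ?\<tau>"
      using i j by (auto simp: A_def B_def)
    \<comment> \<open>The \<open>Suc\<close> is the cut itself, and yields the extra factor \<open>q\<close>.\<close>
    have gain: "gain \<sigma> i j = 2 * real ((k - max i (\<sigma> j)) + Suc (min j (\<sigma> i) - Suc k))"
      using i j by (intro gain_uncross) linarith
    show "exp (- \<beta> * gain \<sigma> i j) * of_bool (good \<sigma>) \<le> g ?\<tau> i j"
      unfolding exp_minus_gain[OF gain] g_def \<tau> using good[OF \<sigma> gd iI j] gd
      by (simp add: power_add)
  qed
  moreover have "E (\<lambda>\<sigma>. of_bool (good \<sigma>) * real (card (Q \<sigma>))) =
      E (\<lambda>\<sigma>. of_bool (good \<sigma>) * (real (card (I \<sigma>)) * real (flux k \<sigma>)))"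
  proof (rule E_cong)
    fix \<sigma> assume \<sigma>: "\<sigma> permutes {1..n}"
    show "of_bool (good \<sigma>) * real (card (Q \<sigma>)) =
        of_bool (good \<sigma>) * (real (card (I \<sigma>)) * real (flux k \<sigma>))"
      by (simp add: Q_def card_cartesian_product card_sources[OF \<sigma>])
  qed
  ultimately show ?thesis by (simp only: E_cmult)
qed

lemma second_moment_flux: "E (\<lambda>\<sigma>. (real (flux k \<sigma>))\<^sup>2) \<le> 4 * q * K\<^sup>2"
  using uncross[of "outs k" k "\<lambda>_. True"] by (simp add: flux_def power2_eq_square)

text \<open>
  As long as the exit of the path of \<open>s\<close> is not touched, uncrossing only adds edges below the cut, and
  the path of \<open>s\<close> still ends at the same exit. Hence one of the \<open>flux k \<sigma>\<close> outgoing edges is excluded.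
\<close>

lemma second_moment_flux_crosses:
  assumes "s \<le> k"
  shows "E (\<lambda>\<sigma>. of_bool (crosses k \<sigma> s) * ((real (flux k \<sigma>) - 1) * real (flux k \<sigma>)))
    \<le> 4 * q * K\<^sup>2 * E (\<lambda>\<sigma>. of_bool (crosses k \<sigma> s))"
proof -
  define t where "t \<sigma> = exit_point (below k \<sigma>) s" for \<sigma>
  have "E (\<lambda>\<sigma>. of_bool (crosses k \<sigma> s) * (real (card (outs k \<sigma> - {t \<sigma>})) * real (flux k \<sigma>)))
    \<le> 4 * q * K\<^sup>2 * E (\<lambda>\<sigma>. of_bool (crosses k \<sigma> s))"
  proof (rule uncross)
    fix \<sigma> i j assume *: "\<sigma> permutes {1..n}" "crosses k \<sigma> s" "i \<in> outs k \<sigma> - {t \<sigma>}" "k < j" "\<sigma> j \<le> k"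
    let ?\<tau> = "\<sigma> \<circ> transp i j"
    note ex = exit_point[OF assms *(2), folded t_def]
    have "below k \<sigma> \<subseteq> below k ?\<tau>"
      using * by (auto simp: below_def outs_def Transposition.transpose_def)
    then have "(s, t \<sigma>) \<in> (below k ?\<tau>)\<^sup>*"
      using ex(1) rtrancl_mono by blast
    moreover have "k < ?\<tau> (t \<sigma>)"
      using ex * by (auto simp: Transposition.transpose_def)
    ultimately show "crosses k ?\<tau> s"
      unfolding crosses_iff_exit[OF assms] using notin_Domain_below[OF ex(2)] by blast
  qed auto
  also have "E (\<lambda>\<sigma>. of_bool (crosses k \<sigma> s) * (real (card (outs k \<sigma> - {t \<sigma>})) * real (flux k \<sigma>)))
     = E (\<lambda>\<sigma>. of_bool (crosses k \<sigma> s) * ((real (flux k \<sigma>) - 1) * real (flux k \<sigma>)))"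
  proof (rule E_cong)
    fix \<sigma> assume \<sigma>: "\<sigma> permutes {1..n}"
    show "of_bool (crosses k \<sigma> s) * (real (card (outs k \<sigma> - {t \<sigma>})) * real (flux k \<sigma>)) =
       of_bool (crosses k \<sigma> s) * ((real (flux k \<sigma>) - 1) * real (flux k \<sigma>))"
    proof (cases "crosses k \<sigma> s")
      case True
      have t: "t \<sigma> \<in> outs k \<sigma>"
        unfolding t_def by (rule exit_point(4)[OF assms True])
      then have "0 < flux k \<sigma>"
        unfolding flux_def using finite_outs card_gt_0_iff by blast
      with t show ?thesis
        by (simp add: flux_def finite_outs of_nat_diff)
    qed simp
  qed
  finally show ?thesis .
qed

lemma flux_pos_of_crosses: "s \<le> k \<Longrightarrow> crosses k \<sigma> s \<Longrightarrow> 0 < flux k \<sigma>"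
  unfolding flux_def using exit_point(4) finite_outs card_gt_0_iff by blast

lemma prob_crosses_le:
  assumes "s \<le> k"
  shows "E (\<lambda>\<sigma>. of_bool (crosses k \<sigma> s)) \<le> 4 * q * K\<^sup>2"
proof -
  have "E (\<lambda>\<sigma>. of_bool (crosses k \<sigma> s)) \<le> E (\<lambda>\<sigma>. (real (flux k \<sigma>))\<^sup>2)"
  proof (rule E_mono)
    fix \<sigma>
    show "of_bool (crosses k \<sigma> s) \<le> (real (flux k \<sigma>))\<^sup>2"
      using flux_pos_of_crosses[OF assms, of \<sigma>] by (cases "crosses k \<sigma> s") (auto simp: Suc_le_eq)
  qed
  also note second_moment_flux
  finally show ?thesis .
qed


section \<open>Closing the cycle\<close>

text \<open>
  The cost of the exchanges that redirect an edge to the point \<open>Suc k\<close>: those with another outgoing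
  edge of the cut are free, and the others have a gain given by their distance to the cut.
\<close>

lemma sum_targets_right_le:
  assumes \<sigma>: "\<sigma> permutes {1..n}"
  shows "(\<Sum>x | x \<in> {1..n} \<and> k < \<sigma> x. if x \<le> k then 1 else q ^ (min x (\<sigma> x) - Suc k))
    \<le> flux k \<sigma> + 2 * K"
proof -
  let ?B = "{x. x \<in> {1..n} \<and> k < x \<and> k < \<sigma> x}"
  have eq: "{x. x \<in> {1..n} \<and> k < \<sigma> x} = outs k \<sigma> \<union> ?B"
    using outs_subset[OF \<sigma>, of k] by (auto simp: outs_def)
  have "(\<Sum>x | x \<in> {1..n} \<and> k < \<sigma> x. if x \<le> k then 1 else q ^ (min x (\<sigma> x) - Suc k))
      = (\<Sum>x\<in>outs k \<sigma>. 1) + (\<Sum>x\<in>?B. q ^ (min x (\<sigma> x) - Suc k))"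
    unfolding eq using finite_outs
    by (subst sum.union_disjoint) (auto simp: outs_def intro!: sum.cong arg_cong2[where f = "(+)"])
  then show ?thesis
    using sum_right_le[OF \<sigma>, of k] by (simp add: flux_def)
qed

lemma sum_points_right_le:
  assumes \<sigma>: "\<sigma> permutes {1..n}"
  shows "(\<Sum>x | x \<in> {1..n} \<and> k < x. if \<sigma> x \<le> k then 1 else q ^ (min x (\<sigma> x) - Suc k))
    \<le> flux k \<sigma> + 2 * K"
proof -
  let ?B = "{x. x \<in> {1..n} \<and> k < x \<and> k < \<sigma> x}" and ?S = "{j. k < j \<and> \<sigma> j \<le> k}"
  have eq: "{x. x \<in> {1..n} \<and> k < x} = ?S \<union> ?B"
    using sources_subset[OF \<sigma>, of k] by auto
  have "(\<Sum>x | x \<in> {1..n} \<and> k < x. if \<sigma> x \<le> k then 1 else q ^ (min x (\<sigma> x) - Suc k))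
      = (\<Sum>x\<in>?S. 1) + (\<Sum>x\<in>?B. q ^ (min x (\<sigma> x) - Suc k))"
    unfolding eq using finite_sources[OF \<sigma>, of k]
    by (subst sum.union_disjoint) (auto intro!: sum.cong arg_cong2[where f = "(+)"])
  then show ?thesis
    using sum_right_le[OF \<sigma>, of k] card_sources[OF \<sigma>, of k] by simp
qed

lemma gain_zero_left:
  fixes k :: nat
  assumes "i \<le> k" "j \<le> k" "k < \<sigma> i" "k < \<sigma> j"
  shows "gain \<sigma> i j = 0"
  using assms by (simp add: gain_def)

lemma gain_zero_right:
  fixes k :: nat
  assumes "\<sigma> i \<le> k" "\<sigma> j \<le> k" "k < i" "k < j"
  shows "gain \<sigma> i j = 0"
  using assms by (simp add: gain_def)

context
  fixes s k :: nat
  assumes s: "s \<in> {1..n}" "s \<le> k" and k: "Suc k \<le> n"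
begin

abbreviation exit_pt :: "(nat \<Rightarrow> nat) \<Rightarrow> nat" where
  "exit_pt \<sigma> \<equiv> exit_point (below k \<sigma>) s"

abbreviation entry_pt :: "(nat \<Rightarrow> nat) \<Rightarrow> nat" where
  "entry_pt \<sigma> \<equiv> entry_point (below k \<sigma>) s"

text \<open>
  The two halves of the event that the cycle of \<open>s\<close> closes at \<open>Suc k\<close>. They are imposed, or removed,
  one at a time, since each corresponds to a single exchange.
\<close>

definition leaves_to_next :: "(nat \<Rightarrow> nat) \<Rightarrow> bool" where
  "leaves_to_next \<sigma> \<longleftrightarrow> crosses k \<sigma> s \<and> \<sigma> (exit_pt \<sigma>) = Suc k"

definition enters_from_next :: "(nat \<Rightarrow> nat) \<Rightarrow> bool" where
  "enters_from_next \<sigma> \<longleftrightarrow> crosses k \<sigma> s \<and> \<sigma> (Suc k) = entry_pt \<sigma>"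

definition closes :: "(nat \<Rightarrow> nat) \<Rightarrow> bool" where
  "closes \<sigma> \<longleftrightarrow> leaves_to_next \<sigma> \<and> enters_from_next \<sigma>"

lemma exit_pt_mem:
  assumes "\<sigma> permutes {1..n}" "crosses k \<sigma> s"
  shows "exit_pt \<sigma> \<in> {1..n}" "exit_pt \<sigma> \<le> k" "k < \<sigma> (exit_pt \<sigma>)"
  using exit_point[OF s(2) assms(2)] subsetD[OF outs_subset[OF assms(1)]] by blast+

lemma entry_pt_source:
  assumes "\<sigma> permutes {1..n}" "crosses k \<sigma> s"
  defines "u \<equiv> inv \<sigma> (entry_pt \<sigma>)"
  shows "u \<in> {1..n}" "k < u" "\<sigma> u = entry_pt \<sigma>" "entry_pt \<sigma> \<le> k"
proof -
  note e = entry_point[OF assms(1) s(2) assms(2)]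
  show *: "\<sigma> u = entry_pt \<sigma>" "k < u" "entry_pt \<sigma> \<le> k"
    using e permutes_inverses(1)[OF assms(1)] by (auto simp: u_def)
  then have "u \<in> {j. k < j \<and> \<sigma> j \<le> k}" by simp
  with sources_subset[OF assms(1)] show "u \<in> {1..n}" by blast
qed

lemma next_source:
  assumes "\<sigma> permutes {1..n}"
  defines "x \<equiv> inv \<sigma> (Suc k)"
  shows "x \<in> {1..n}" "\<sigma> x = Suc k"
proof -
  show "\<sigma> x = Suc k" using permutes_inverses(1)[OF assms(1)] by (simp add: x_def)
  have "inv \<sigma> permutes {1..n}" using assms(1) by (rule permutes_inv)
  then show "x \<in> {1..n}" using k unfolding x_def by (subst permutes_in_image) auto
qed

text \<open>
  All four exchanges that follow preserve the relation \<open>below\<close>, so an arbitrary function of the flux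
  may be carried along.
\<close>

lemma below_swap_invariants:
  assumes "below k \<tau> = below k \<sigma>"
  shows "crosses k \<tau> s \<longleftrightarrow> crosses k \<sigma> s" "exit_pt \<tau> = exit_pt \<sigma>" "entry_pt \<tau> = entry_pt \<sigma>"
    "flux k \<tau> = flux k \<sigma>"
  using assms crosses_cong_below[OF s(2) assms] flux_cong_below[OF assms] by simp_all

text \<open>
  Exchange the images of the exit and of the preimage \<open>x\<close> of \<open>Suc k\<close>. The exit can be read off from
  the new permutation; what has to be summed over is \<open>x\<close>.
\<close>

lemma crosses_le_leaves_to_next:
  fixes \<phi> :: "nat \<Rightarrow> real"
  assumes \<phi>: "\<And>d. 0 \<le> \<phi> d"
  shows "E (\<lambda>\<sigma>. of_bool (crosses k \<sigma> s) * \<phi> (flux k \<sigma>))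
    \<le> E (\<lambda>\<sigma>. of_bool (leaves_to_next \<sigma>) * (\<phi> (flux k \<sigma>) * (flux k \<sigma> + 2 * K)))"
proof -
  define Q where "Q \<sigma> = (if crosses k \<sigma> s then {(exit_pt \<sigma>, inv \<sigma> (Suc k))} else {})" for \<sigma>
  define R where "R \<sigma> = (if leaves_to_next \<sigma>
    then {exit_pt \<sigma>} \<times> {x. x \<in> {1..n} \<and> k < \<sigma> x} else {})" for \<sigma>
  define g where "g \<sigma> i x = \<phi> (flux k \<sigma>) * (if x \<le> k then 1 else q ^ (min x (\<sigma> x) - Suc k))"
    for \<sigma> and i x :: nat
  have "E (\<lambda>\<sigma>. \<phi> (flux k \<sigma>) * real (card (Q \<sigma>)))
    \<le> E (\<lambda>\<sigma>. of_bool (leaves_to_next \<sigma>) * (\<phi> (flux k \<sigma>) * (flux k \<sigma> + 2 * K)))"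
  proof (rule exchange_bound[where R = R and g = g])
    fix \<sigma> assume \<sigma>: "\<sigma> permutes {1..n}"
    show "Q \<sigma> \<subseteq> {1..n} \<times> {1..n}"
      using exit_pt_mem(1)[OF \<sigma>] next_source(1)[OF \<sigma>] by (simp add: Q_def)
    show "R \<sigma> \<subseteq> {1..n} \<times> {1..n}"
      using exit_pt_mem(1)[OF \<sigma>] by (auto simp: R_def leaves_to_next_def)
    show "(\<Sum>(i, x)\<in>R \<sigma>. g \<sigma> i x)
        \<le> of_bool (leaves_to_next \<sigma>) * (\<phi> (flux k \<sigma>) * (flux k \<sigma> + 2 * K))"
    proof (cases "leaves_to_next \<sigma>")
      case True
      have "(\<Sum>(i, x)\<in>R \<sigma>. g \<sigma> i x) = \<phi> (flux k \<sigma>) *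
          (\<Sum>x | x \<in> {1..n} \<and> k < \<sigma> x. if x \<le> k then 1 else q ^ (min x (\<sigma> x) - Suc k))"
        using True unfolding R_def g_def
        by (simp add: sum.cartesian_product[symmetric] sum_distrib_left)
      also have "\<dots> \<le> \<phi> (flux k \<sigma>) * (flux k \<sigma> + 2 * K)"
        by (intro mult_left_mono sum_targets_right_le \<sigma> \<phi>)
      finally show ?thesis using True by simp
    qed (simp add: R_def)
  next
    fix \<sigma> i x assume \<sigma>: "\<sigma> permutes {1..n}" and ix: "(i, x) \<in> R \<sigma>"
    show "0 \<le> g \<sigma> i x" using \<phi> q_pow_nonneg by (simp add: g_def)
  next
    fix \<sigma> i x assume \<sigma>: "\<sigma> permutes {1..n}" and "(i, x) \<in> Q \<sigma>"
    then have cr: "crosses k \<sigma> s" and i: "i = exit_pt \<sigma>" and x: "x = inv \<sigma> (Suc k)"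
      by (auto simp: Q_def split: if_splits)
    let ?\<tau> = "\<sigma> \<circ> transp i x"
    note ex = exit_pt_mem[OF \<sigma> cr, folded i]
    note nx = next_source[OF \<sigma>, folded x]
    have \<tau>: "?\<tau> i = Suc k" "?\<tau> x = \<sigma> i" using nx by auto
    have "below k ?\<tau> = below k \<sigma>"
      using ex nx by (intro below_swap) auto
    note inv = below_swap_invariants[OF this]
    show "(i, x) \<in> R ?\<tau>"
      using inv cr nx(1) ex(3) \<tau> unfolding R_def leaves_to_next_def i[symmetric] by simp
    have "exp (- \<beta> * gain \<sigma> i x) = (if x \<le> k then 1 else q ^ (min x (\<sigma> i) - Suc k))"
    proof (cases "x \<le> k")
      case True
      then show ?thesis using gain_zero_left[of i k x \<sigma>] ex nx by simp
    next
      case False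
      have "gain \<sigma> i x = 2 * real (min x (\<sigma> i) - Suc k)"
        using False ex nx by (intro gain_uncross) auto
      then show ?thesis using False exp_minus_gain by simp
    qed
    then show "exp (- \<beta> * gain \<sigma> i x) * \<phi> (flux k \<sigma>) \<le> g ?\<tau> i x"
      unfolding g_def inv \<tau> by (simp add: mult.commute)
  qed
  moreover have "E (\<lambda>\<sigma>. \<phi> (flux k \<sigma>) * real (card (Q \<sigma>))) =
      E (\<lambda>\<sigma>. of_bool (crosses k \<sigma> s) * \<phi> (flux k \<sigma>))"
    by (intro E_cong) (simp add: Q_def)
  ultimately show ?thesis by simp
qed

text \<open>
  Exchange the images of \<open>Suc k\<close> and of the preimage \<open>u\<close> of the entry; what has to be summed over
  is \<open>u\<close>.
\<close>

lemma leaves_to_next_le_closes: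
  fixes \<phi> :: "nat \<Rightarrow> real"
  assumes \<phi>: "\<And>d. 0 \<le> \<phi> d"
  shows "E (\<lambda>\<sigma>. of_bool (leaves_to_next \<sigma>) * \<phi> (flux k \<sigma>))
    \<le> E (\<lambda>\<sigma>. of_bool (closes \<sigma>) * (\<phi> (flux k \<sigma>) * (flux k \<sigma> + 2 * K)))"
proof -
  define Q where "Q \<sigma> = (if leaves_to_next \<sigma> then {(Suc k, inv \<sigma> (entry_pt \<sigma>))} else {})" for \<sigma>
  define R where "R \<sigma> = (if closes \<sigma> then {Suc k} \<times> {u. u \<in> {1..n} \<and> k < u} else {})" for \<sigma>
  define g where "g \<sigma> i u = \<phi> (flux k \<sigma>) * (if \<sigma> u \<le> k then 1 else q ^ (min u (\<sigma> u) - Suc k))"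
    for \<sigma> and i u :: nat
  have "E (\<lambda>\<sigma>. \<phi> (flux k \<sigma>) * real (card (Q \<sigma>)))
    \<le> E (\<lambda>\<sigma>. of_bool (closes \<sigma>) * (\<phi> (flux k \<sigma>) * (flux k \<sigma> + 2 * K)))"
  proof (rule exchange_bound[where R = R and g = g])
    fix \<sigma> assume \<sigma>: "\<sigma> permutes {1..n}"
    show "Q \<sigma> \<subseteq> {1..n} \<times> {1..n}"
      using entry_pt_source(1)[OF \<sigma>] k by (simp add: Q_def leaves_to_next_def)
    show "R \<sigma> \<subseteq> {1..n} \<times> {1..n}"
      using k by (auto simp: R_def)
    show "(\<Sum>(i, u)\<in>R \<sigma>. g \<sigma> i u)
        \<le> of_bool (closes \<sigma>) * (\<phi> (flux k \<sigma>) * (flux k \<sigma> + 2 * K))"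
    proof (cases "closes \<sigma>")
      case True
      have "(\<Sum>(i, u)\<in>R \<sigma>. g \<sigma> i u) = \<phi> (flux k \<sigma>) *
          (\<Sum>u | u \<in> {1..n} \<and> k < u. if \<sigma> u \<le> k then 1 else q ^ (min u (\<sigma> u) - Suc k))"
        using True unfolding R_def g_def
        by (simp add: sum.cartesian_product[symmetric] sum_distrib_left)
      also have "\<dots> \<le> \<phi> (flux k \<sigma>) * (flux k \<sigma> + 2 * K)"
        by (intro mult_left_mono sum_points_right_le \<sigma> \<phi>)
      finally show ?thesis using True by simp
    qed (simp add: R_def)
  next
    fix \<sigma> i u assume \<sigma>: "\<sigma> permutes {1..n}" and iu: "(i, u) \<in> R \<sigma>"
    show "0 \<le> g \<sigma> i u" using \<phi> q_pow_nonneg by (simp add: g_def)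
  next
    fix \<sigma> i u assume \<sigma>: "\<sigma> permutes {1..n}" and "(i, u) \<in> Q \<sigma>"
    then have lv: "leaves_to_next \<sigma>" and i: "i = Suc k" and u: "u = inv \<sigma> (entry_pt \<sigma>)"
      by (auto simp: Q_def split: if_splits)
    have cr: "crosses k \<sigma> s" using lv by (simp add: leaves_to_next_def)
    let ?\<tau> = "\<sigma> \<circ> transp i u"
    note en = entry_pt_source[OF \<sigma> cr, folded u]
    have \<tau>: "?\<tau> i = entry_pt \<sigma>" "?\<tau> u = \<sigma> i" using en by auto
    have ki: "k < i" by (simp add: i)
    have "below k ?\<tau> = below k \<sigma>"
      using en ki by (intro below_swap) auto
    note inv = below_swap_invariants[OF this]
    have "?\<tau> (exit_pt \<sigma>) = \<sigma> (exit_pt \<sigma>)"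
      using exit_pt_mem[OF \<sigma> cr] en(2) ki by (auto simp: Transposition.transpose_def)
    then have "closes ?\<tau>"
      using lv \<tau>(1) unfolding closes_def leaves_to_next_def enters_from_next_def i[symmetric] inv by simp
    then show "(i, u) \<in> R ?\<tau>"
      using en(1,2) i by (simp add: R_def)
    have "exp (- \<beta> * gain \<sigma> i u) = (if \<sigma> i \<le> k then 1 else q ^ (min u (\<sigma> i) - Suc k))"
    proof (cases "\<sigma> i \<le> k")
      case True
      then show ?thesis using gain_zero_right[of \<sigma> i k u] en ki by simp
    next
      case False
      have "gain \<sigma> i u = 2 * real (min u (\<sigma> i) - Suc k)"
        using False en i by (intro gain_uncross) auto
      then show ?thesis using False exp_minus_gain by simp
    qed
    then show "exp (- \<beta> * gain \<sigma> i u) * \<phi> (flux k \<sigma>) \<le> g ?\<tau> i u"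
      unfolding g_def inv \<tau> by (simp add: mult.commute)
  qed
  moreover have "E (\<lambda>\<sigma>. \<phi> (flux k \<sigma>) * real (card (Q \<sigma>))) =
      E (\<lambda>\<sigma>. of_bool (leaves_to_next \<sigma>) * \<phi> (flux k \<sigma>))"
    by (intro E_cong) (simp add: Q_def)
  ultimately show ?thesis by simp
qed

text \<open>
  The converse direction, restricted to the exchanges of weight one: the image \<open>Suc k\<close> of the exit can
  be given to any of the \<open>flux k \<sigma>\<close> exits, and its new owner is the preimage of \<open>Suc k\<close>.
\<close>

lemma closes_le_enters_from_next:
  fixes \<phi> :: "nat \<Rightarrow> real"
  assumes \<phi>: "\<And>d. 0 \<le> \<phi> d"
  shows "E (\<lambda>\<sigma>. of_bool (closes \<sigma>) * (\<phi> (flux k \<sigma>) * flux k \<sigma>))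
    \<le> E (\<lambda>\<sigma>. of_bool (enters_from_next \<sigma>) * \<phi> (flux k \<sigma>))"
proof -
  define Q where "Q \<sigma> = (if closes \<sigma> then {exit_pt \<sigma>} \<times> outs k \<sigma> else {})" for \<sigma>
  define R where "R \<sigma> = (if enters_from_next \<sigma> then {(exit_pt \<sigma>, inv \<sigma> (Suc k))} else {})" for \<sigma>
  have "E (\<lambda>\<sigma>. \<phi> (flux k \<sigma>) * real (card (Q \<sigma>)))
    \<le> E (\<lambda>\<sigma>. of_bool (enters_from_next \<sigma>) * \<phi> (flux k \<sigma>))"
  proof (rule exchange_bound[where R = R and g = "\<lambda>\<sigma> i j. \<phi> (flux k \<sigma>)"])
    fix \<sigma> assume \<sigma>: "\<sigma> permutes {1..n}"
    show "Q \<sigma> \<subseteq> {1..n} \<times> {1..n}"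
      using exit_pt_mem(1)[OF \<sigma>] outs_subset[OF \<sigma>, of k]
      by (auto simp: Q_def closes_def leaves_to_next_def)
    show "R \<sigma> \<subseteq> {1..n} \<times> {1..n}"
      using exit_pt_mem(1)[OF \<sigma>] next_source(1)[OF \<sigma>] by (simp add: R_def enters_from_next_def)
    show "(\<Sum>(i, x)\<in>R \<sigma>. \<phi> (flux k \<sigma>)) \<le> of_bool (enters_from_next \<sigma>) * \<phi> (flux k \<sigma>)"
      by (simp add: R_def)
  next
    fix \<sigma> and i x :: nat assume "\<sigma> permutes {1..n}"
    show "0 \<le> \<phi> (flux k \<sigma>)" by (rule \<phi>)
  next
    fix \<sigma> i x assume \<sigma>: "\<sigma> permutes {1..n}" and "(i, x) \<in> Q \<sigma>"
    then have cl: "closes \<sigma>" and i: "i = exit_pt \<sigma>" and x: "x \<in> outs k \<sigma>"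
      by (auto simp: Q_def split: if_splits)
    have cr: "crosses k \<sigma> s" and \<sigma>i: "\<sigma> i = Suc k" and \<sigma>p: "\<sigma> (Suc k) = entry_pt \<sigma>"
      using cl by (auto simp: closes_def leaves_to_next_def enters_from_next_def i)
    let ?\<tau> = "\<sigma> \<circ> transp i x"
    note ex = exit_pt_mem[OF \<sigma> cr, folded i]
    have xk: "x \<le> k" "k < \<sigma> x" using x by (auto simp: outs_def)
    have "below k ?\<tau> = below k \<sigma>"
      using ex xk by (intro below_swap) auto
    note inv = below_swap_invariants[OF this]
    have "?\<tau> (Suc k) = \<sigma> (Suc k)"
      using ex(2) xk(1) by (auto simp: Transposition.transpose_def)
    then have "enters_from_next ?\<tau>"
      using cr \<sigma>p unfolding enters_from_next_def inv by simp
    moreover have "Hilbert_Choice.inv ?\<tau> (Suc k) = x"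
    proof -
      have "?\<tau> permutes {1..n}"
        using \<sigma> ex(1) subsetD[OF outs_subset[OF \<sigma>] x] by (intro permutes_compose permutes_swap_id) auto
      moreover have "?\<tau> x = Suc k" using \<sigma>i by simp
      ultimately show ?thesis by (metis permutes_inverses(2))
    qed
    ultimately show "(i, x) \<in> R ?\<tau>"
      unfolding R_def inv using i by simp
    show "exp (- \<beta> * gain \<sigma> i x) * \<phi> (flux k \<sigma>) \<le> \<phi> (flux k ?\<tau>)"
      using gain_zero_left[of i k x \<sigma>] ex xk inv(4) by simp
  qed
  moreover have "E (\<lambda>\<sigma>. \<phi> (flux k \<sigma>) * real (card (Q \<sigma>))) =
      E (\<lambda>\<sigma>. of_bool (closes \<sigma>) * (\<phi> (flux k \<sigma>) * flux k \<sigma>))"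
    by (intro E_cong) (simp add: Q_def flux_def card_cartesian_product)
  ultimately show ?thesis by simp
qed

text \<open>
  Likewise the image of \<open>Suc k\<close> can be traded for any of the \<open>flux k \<sigma>\<close> entry points.
\<close>

lemma enters_from_next_le_crosses:
  fixes \<phi> :: "nat \<Rightarrow> real"
  assumes \<phi>: "\<And>d. 0 \<le> \<phi> d"
  shows "E (\<lambda>\<sigma>. of_bool (enters_from_next \<sigma>) * (\<phi> (flux k \<sigma>) * flux k \<sigma>))
    \<le> E (\<lambda>\<sigma>. of_bool (crosses k \<sigma> s) * \<phi> (flux k \<sigma>))"
proof -
  define Q where "Q \<sigma> = (if enters_from_next \<sigma> then {Suc k} \<times> {j. k < j \<and> \<sigma> j \<le> k} else {})" for \<sigma>
  define R where "R \<sigma> = (if crosses k \<sigma> s then {(Suc k, inv \<sigma> (entry_pt \<sigma>))} else {})" for \<sigma>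
  have "E (\<lambda>\<sigma>. \<phi> (flux k \<sigma>) * real (card (Q \<sigma>)))
    \<le> E (\<lambda>\<sigma>. of_bool (crosses k \<sigma> s) * \<phi> (flux k \<sigma>))"
  proof (rule exchange_bound[where R = R and g = "\<lambda>\<sigma> i j. \<phi> (flux k \<sigma>)"])
    fix \<sigma> assume \<sigma>: "\<sigma> permutes {1..n}"
    show "Q \<sigma> \<subseteq> {1..n} \<times> {1..n}"
      using sources_subset[OF \<sigma>, of k] k by (auto simp: Q_def)
    show "R \<sigma> \<subseteq> {1..n} \<times> {1..n}"
      using entry_pt_source(1)[OF \<sigma>] k by (simp add: R_def)
    show "(\<Sum>(i, x)\<in>R \<sigma>. \<phi> (flux k \<sigma>)) \<le> of_bool (crosses k \<sigma> s) * \<phi> (flux k \<sigma>)"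
      by (simp add: R_def)
  next
    fix \<sigma> and i x :: nat assume "\<sigma> permutes {1..n}"
    show "0 \<le> \<phi> (flux k \<sigma>)" by (rule \<phi>)
  next
    fix \<sigma> i u assume \<sigma>: "\<sigma> permutes {1..n}" and "(i, u) \<in> Q \<sigma>"
    then have en: "enters_from_next \<sigma>" and i: "i = Suc k" and u: "k < u" "\<sigma> u \<le> k"
      by (auto simp: Q_def split: if_splits)
    have cr: "crosses k \<sigma> s" and \<sigma>i: "\<sigma> i = entry_pt \<sigma>"
      using en by (auto simp: enters_from_next_def i)
    have le: "entry_pt \<sigma> \<le> k" by (rule entry_pt_source(4)[OF \<sigma> cr])
    let ?\<tau> = "\<sigma> \<circ> transp i u"
    have "below k ?\<tau> = below k \<sigma>"
      using i u by (intro below_swap) auto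
    note inv = below_swap_invariants[OF this]
    have "Hilbert_Choice.inv ?\<tau> (entry_pt \<sigma>) = u"
    proof -
      have "u \<in> {1..n}" using u sources_subset[OF \<sigma>, of k] by blast
      then have "?\<tau> permutes {1..n}"
        using \<sigma> k i by (intro permutes_compose permutes_swap_id) auto
      moreover have "?\<tau> u = entry_pt \<sigma>" using \<sigma>i by simp
      ultimately show ?thesis by (metis permutes_inverses(2))
    qed
    then show "(i, u) \<in> R ?\<tau>"
      unfolding R_def i[symmetric] inv using cr by simp
    show "exp (- \<beta> * gain \<sigma> i u) * \<phi> (flux k \<sigma>) \<le> \<phi> (flux k ?\<tau>)"
      using gain_zero_right[of \<sigma> i k u] i u \<sigma>i le inv(4) by simp
  qed
  moreover have "E (\<lambda>\<sigma>. \<phi> (flux k \<sigma>) * real (card (Q \<sigma>))) =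
      E (\<lambda>\<sigma>. of_bool (enters_from_next \<sigma>) * (\<phi> (flux k \<sigma>) * flux k \<sigma>))"
    by (intro E_cong) (simp add: Q_def card_cartesian_product card_sources)
  ultimately show ?thesis by simp
qed

lemma closes_iff:
  assumes "\<sigma> permutes {1..n}"
  shows "closes \<sigma> \<longleftrightarrow> crosses k \<sigma> s \<and> \<not> crosses (Suc k) \<sigma> s"
  using crosses_Suc_iff[OF assms s(2)]
  by (auto simp: closes_def leaves_to_next_def enters_from_next_def)

lemma prob_closes:
  "E (\<lambda>\<sigma>. of_bool (closes \<sigma>)) = E (\<lambda>\<sigma>. of_bool (crosses k \<sigma> s)) - E (\<lambda>\<sigma>. of_bool (crosses (Suc k) \<sigma> s))"
proof -
  have "E (\<lambda>\<sigma>. of_bool (crosses k \<sigma> s)) = E (\<lambda>\<sigma>. of_bool (closes \<sigma>) + of_bool (crosses (Suc k) \<sigma> s))"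
  proof (rule E_cong)
    fix \<sigma> assume \<sigma>: "\<sigma> permutes {1..n}"
    have "crosses (Suc k) \<sigma> s \<Longrightarrow> crosses k \<sigma> s"
      by (metis crosses_def Suc_lessD)
    then show "(of_bool (crosses k \<sigma> s) :: real) = of_bool (closes \<sigma>) + of_bool (crosses (Suc k) \<sigma> s)"
      by (auto simp: closes_iff[OF \<sigma>])
  qed
  then show ?thesis by (simp add: E_add)
qed

lemma prob_closes_ge:
  "E (\<lambda>\<sigma>. of_bool (crosses k \<sigma> s) * (1 / (real (flux k \<sigma>) + 2 * K)\<^sup>2)) \<le> E (\<lambda>\<sigma>. of_bool (closes \<sigma>))"
proof -
  have pos: "0 < real d + 2 * K" for d using K_ge_1 by linarith
  have eq: "1 / (real d + 2 * K)\<^sup>2 * (real d + 2 * K) = 1 / (real d + 2 * K)"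
      "1 / (real d + 2 * K) * (real d + 2 * K) = 1" for d
    using pos[of d] by (auto simp: power2_eq_square)
  show ?thesis
    using crosses_le_leaves_to_next[of "\<lambda>d. 1 / (real d + 2 * K)\<^sup>2"]
      leaves_to_next_le_closes[of "\<lambda>d. 1 / (real d + 2 * K)"] pos[THEN less_imp_le]
    unfolding eq by simp
qed

text \<open>
  The shift of the flux by one keeps the right-hand side meaningful when the flux vanishes; as the flux is
  positive if the cycle crosses, it costs the factor \<open>4\<close>.
\<close>

lemma prob_closes_le:
  "E (\<lambda>\<sigma>. of_bool (closes \<sigma>)) \<le> 4 * E (\<lambda>\<sigma>. 1 / (real (flux k \<sigma>) + 1)\<^sup>2)"
proof -
  have eq: "1 / (real (flux k \<sigma>))\<^sup>2 * real (flux k \<sigma>) = 1 / real (flux k \<sigma>)" for \<sigma>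
    by (simp add: power2_eq_square)
  have "E (\<lambda>\<sigma>. of_bool (closes \<sigma>)) = E (\<lambda>\<sigma>. of_bool (closes \<sigma>) * (1 / real (flux k \<sigma>) * real (flux k \<sigma>)))"
  proof (rule E_cong)
    fix \<sigma>
    show "of_bool (closes \<sigma>) = of_bool (closes \<sigma>) * (1 / real (flux k \<sigma>) * real (flux k \<sigma>))"
      using flux_pos_of_crosses[OF s(2), of \<sigma>] by (auto simp: closes_def leaves_to_next_def)
  qed
  also have "\<dots> \<le> E (\<lambda>\<sigma>. of_bool (enters_from_next \<sigma>) * (1 / real (flux k \<sigma>)))"
    by (rule closes_le_enters_from_next) simp
  also have "\<dots> \<le> E (\<lambda>\<sigma>. of_bool (crosses k \<sigma> s) * (1 / (real (flux k \<sigma>))\<^sup>2))"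
    using enters_from_next_le_crosses[of "\<lambda>d. 1 / (real d)\<^sup>2"] unfolding eq by simp
  also have "\<dots> \<le> E (\<lambda>\<sigma>. 4 * (1 / (real (flux k \<sigma>) + 1)\<^sup>2))"
  proof (rule E_mono)
    fix \<sigma>
    show "of_bool (crosses k \<sigma> s) * (1 / (real (flux k \<sigma>))\<^sup>2) \<le> 4 * (1 / (real (flux k \<sigma>) + 1)\<^sup>2)"
    proof (cases "crosses k \<sigma> s")
      case True
      then have "1 \<le> real (flux k \<sigma>)" using flux_pos_of_crosses[OF s(2), of \<sigma>] by simp
      then have "(real (flux k \<sigma>) + 1)\<^sup>2 \<le> (2 * real (flux k \<sigma>))\<^sup>2" by (intro power_mono) auto
      with \<open>1 \<le> real (flux k \<sigma>)\<close> show ?thesis by (simp add: True field_simps)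
    qed simp
  qed
  finally show ?thesis by (simp only: E_cmult)
qed

end


section \<open>Geometric decay of the crossing probabilities\<close>

text \<open>
  The closing probability is at least the expectation of \<open>1 / z\<close> over the crossing event, where
  \<open>z = (flux + 2 * K)\<^sup>2\<close>, and \<open>z\<close> has conditional mean at most \<open>m = 26 * K\<^sup>2\<close>. Convexity, in the form
  of the tangent bound \<open>1 / z \<ge> 2 / m - z / m\<^sup>2\<close>, turns this into a conditional probability of at least
  \<open>1 / m\<close>.
\<close>

lemma crosses_decay:
  assumes s: "s \<in> {1..n}" "s \<le> k" and k: "Suc k \<le> n"
  defines "p \<equiv> \<lambda>k. E (\<lambda>\<sigma>. of_bool (crosses k \<sigma> s))"
  shows "p k \<le> 26 * K\<^sup>2 * (p k - p (Suc k))"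
proof -
  define m where "m = 26 * K\<^sup>2"
  define z where "z d = (real d + 2 * K)\<^sup>2" for d
  define c where "c \<sigma> = (of_bool (crosses k \<sigma> s) :: real)" for \<sigma>
  have K1: "1 \<le> K\<^sup>2" using K_ge_1 by simp
  have m: "0 < m" using K_ge_1 by (simp add: m_def)
  have zpos: "0 < z d" for d
    using K_ge_1 by (auto simp: z_def intro!: zero_less_power add_nonneg_pos)
  have p0: "0 \<le> p k" unfolding p_def by (rule E_nonneg) simp
  have second: "E (\<lambda>\<sigma>. c \<sigma> * z (flux k \<sigma>)) \<le> m * p k"
  proof -
    have "E (\<lambda>\<sigma>. c \<sigma> * z (flux k \<sigma>)) \<le>
      E (\<lambda>\<sigma>. 4 * (c \<sigma> * ((real (flux k \<sigma>) - 1) * real (flux k \<sigma>))) + (2 + 8 * K\<^sup>2) * c \<sigma>)"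
    proof (rule E_mono)
      fix \<sigma>
      let ?d = "real (flux k \<sigma>)"
      \<comment> \<open>This is exactly the difference of the two sides of the bound on \<open>z\<close>.\<close>
      have "0 \<le> (?d - 2 * K)\<^sup>2 + 2 * (?d - 1)\<^sup>2"
        by simp
      then have "z (flux k \<sigma>) \<le> 4 * ((?d - 1) * ?d) + (2 + 8 * K\<^sup>2)"
        by (simp add: z_def power2_eq_square algebra_simps)
      from mult_left_mono[OF this, of "c \<sigma>"]
      show "c \<sigma> * z (flux k \<sigma>) \<le> 4 * (c \<sigma> * ((?d - 1) * ?d)) + (2 + 8 * K\<^sup>2) * c \<sigma>"
        by (simp add: c_def algebra_simps)
    qed
    also have "\<dots> = 4 * E (\<lambda>\<sigma>. c \<sigma> * ((real (flux k \<sigma>) - 1) * real (flux k \<sigma>))) + (2 + 8 * K\<^sup>2) * p k"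
      by (simp add: E_add E_cmult p_def c_def del: Bochner_Integration.integral_mult_right_zero)
    also have "\<dots> \<le> 4 * (4 * q * K\<^sup>2 * p k) + (2 + 8 * K\<^sup>2) * p k"
      using second_moment_flux_crosses[OF s(2)] by (simp add: c_def p_def)
    also have "\<dots> = (16 * (q * K\<^sup>2) + 2 + 8 * K\<^sup>2) * p k"
      by (simp add: algebra_simps)
    also have "\<dots> \<le> m * p k"
    proof (rule mult_right_mono[OF _ p0])
      have "q * K\<^sup>2 \<le> 1 * K\<^sup>2" using q_bounds by (intro mult_right_mono) auto
      with K1 show "16 * (q * K\<^sup>2) + 2 + 8 * K\<^sup>2 \<le> m" by (simp add: m_def)
    qed
    finally show ?thesis .
  qed
  have "2 / m * p k = E (\<lambda>\<sigma>. 2 / m * c \<sigma>)"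
    unfolding p_def c_def by (rule E_cmult[symmetric])
  also have "\<dots> \<le> E (\<lambda>\<sigma>. c \<sigma> * (1 / z (flux k \<sigma>)) + 1 / m\<^sup>2 * (c \<sigma> * z (flux k \<sigma>)))"
  proof (rule E_mono)
    fix \<sigma>
    let ?z = "z (flux k \<sigma>)"
    have "0 \<le> (1 - ?z / m)\<^sup>2 / ?z" using zpos[of "flux k \<sigma>"] by simp
    also have "\<dots> = 1 / ?z - 2 / m + ?z / m\<^sup>2"
      using zpos[of "flux k \<sigma>"] m by (simp add: field_simps power2_eq_square)
    finally have "2 / m \<le> 1 / ?z + ?z / m\<^sup>2" by simp
    from mult_left_mono[OF this, of "c \<sigma>"]
    show "2 / m * c \<sigma> \<le> c \<sigma> * (1 / ?z) + 1 / m\<^sup>2 * (c \<sigma> * ?z)"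
      by (simp add: c_def algebra_simps)
  qed
  also have "\<dots> = E (\<lambda>\<sigma>. c \<sigma> * (1 / z (flux k \<sigma>))) + 1 / m\<^sup>2 * E (\<lambda>\<sigma>. c \<sigma> * z (flux k \<sigma>))"
    by (simp only: E_add E_cmult)
  also have "\<dots> \<le> (p k - p (Suc k)) + 1 / m\<^sup>2 * (m * p k)"
    using prob_closes_ge[OF s k] prob_closes[OF s k] second m
    unfolding p_def c_def z_def by (intro add_mono mult_left_mono) auto
  also have "1 / m\<^sup>2 * (m * p k) = p k / m"
    using m by (simp add: power2_eq_square)
  finally have "p k / m \<le> p k - p (Suc k)" by simp
  then show ?thesis
    using m by (simp add: m_def field_simps)
qed

lemma cycle_facts:
  assumes "\<sigma> permutes {1..n}" "s \<in> {1..n}"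
  shows "finite (orbit \<sigma> s)" "orbit \<sigma> s \<noteq> {}" "s \<in> orbit \<sigma> s" "orbit \<sigma> s \<subseteq> {1..n}"
  using cycle_of_self_subset[OF assms] finite_subset by blast+

lemma crosses_iff_less_Max:
  assumes "\<sigma> permutes {1..n}" "s \<in> {1..n}"
  shows "crosses k \<sigma> s \<longleftrightarrow> k < Max (orbit \<sigma> s)"
  using cycle_facts[OF assms] by (simp add: crosses_def Max_gr_iff)

lemma Max_cycle_minus_start:
  assumes "\<sigma> permutes {1..n}" "s \<in> {1..n}"
  shows "real (Max (orbit \<sigma> s)) - real s = (\<Sum>k = s..<n. of_bool (crosses k \<sigma> s))"
proof -
  note c = cycle_facts[OF assms]
  have "Max (orbit \<sigma> s) \<in> orbit \<sigma> s" using c by (intro Max_in)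
  then have le: "s \<le> Max (orbit \<sigma> s)" "Max (orbit \<sigma> s) \<le> n"
    using c by (auto intro: Max_ge)
  have "{s..<n} \<inter> {k. crosses k \<sigma> s} = {s..<Max (orbit \<sigma> s)}"
    using le by (auto simp: crosses_iff_less_Max[OF assms])
  then show ?thesis
    using le by simp
qed

lemma expected_Max_cycle:
  assumes "s \<in> {1..n}"
  shows "E (\<lambda>\<sigma>. real (Max (orbit \<sigma> s)) - real s) = (\<Sum>k = s..<n. E (\<lambda>\<sigma>. of_bool (crosses k \<sigma> s)))"
proof -
  have "E (\<lambda>\<sigma>. real (Max (orbit \<sigma> s)) - real s) = E (\<lambda>\<sigma>. \<Sum>k = s..<n. of_bool (crosses k \<sigma> s))"
    using assms by (intro E_cong Max_cycle_minus_start)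
  also have "\<dots> = (\<Sum>k = s..<n. E (\<lambda>\<sigma>. of_bool (crosses k \<sigma> s)))"
    by (intro Bochner_Integration.integral_sum integrable_E)
  finally show ?thesis .
qed

text \<open>
  Summing the decay inequality over all cuts to the right of \<open>s\<close> telescopes.
\<close>

lemma expected_Max_cycle_le:
  assumes s: "s \<in> {1..n}"
  shows "E (\<lambda>\<sigma>. real (Max (orbit \<sigma> s)) - real s) \<le> 26 * K\<^sup>2 * min 1 (4 * q * K\<^sup>2)"
proof -
  define p where "p k = E (\<lambda>\<sigma>. of_bool (crosses k \<sigma> s))" for k
  have p0: "0 \<le> p k" for k unfolding p_def by (rule E_nonneg) simp
  have p1: "p k \<le> 1" for k
    using E_mono[of "\<lambda>\<sigma>. of_bool (crosses k \<sigma> s)" "\<lambda>_. 1"] by (simp add: p_def)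
  have "E (\<lambda>\<sigma>. real (Max (orbit \<sigma> s)) - real s) = (\<Sum>k = s..<n. p k)"
    unfolding p_def by (rule expected_Max_cycle[OF s])
  also have "\<dots> \<le> (\<Sum>k = s..<n. 26 * K\<^sup>2 * (p k - p (Suc k)))"
    using s unfolding p_def by (intro sum_mono crosses_decay) auto
  also have "\<dots> = 26 * K\<^sup>2 * (p s - p n)"
  proof -
    have "(\<Sum>k = s..<n. p k - p (Suc k)) = p s - p n"
      using s sum_Suc_diff'[of s n "\<lambda>k. - p k"] by simp
    then show ?thesis by (simp add: sum_distrib_left[symmetric])
  qed
  also have "\<dots> \<le> 26 * K\<^sup>2 * min 1 (4 * q * K\<^sup>2)"
  proof (rule mult_left_mono)
    have "p s \<le> 4 * q * K\<^sup>2" unfolding p_def by (rule prob_crosses_le) simp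
    then show "p s - p n \<le> min 1 (4 * q * K\<^sup>2)" using p0[of n] p1[of s] by simp
  qed simp
  finally show ?thesis .
qed

section \<open>Reflection\<close>

text \<open>
  Conjugation with the reversal of \<open>{1..n}\<close> preserves the measure and exchanges maxima and minima of
  cycles.
\<close>

definition mirror :: "nat \<Rightarrow> nat" where
  "mirror j = (if j \<in> {1..n} then n + 1 - j else j)"

lemma mirror_mirror [simp]: "mirror (mirror j) = j"
  by (auto simp: mirror_def)

lemma mirror_permutes: "mirror permutes {1..n}"
  by (rule bij_imp_permutes) (auto simp: mirror_def intro!: bij_betwI[of _ _ _ mirror])

lemma pr_mirror:
  assumes "\<sigma> permutes {1..n}"
  shows "pr (mirror \<circ> \<sigma> \<circ> mirror) = pr \<sigma>"
proof -
  have perm: "(mirror \<circ> \<sigma> \<circ> mirror) permutes {1..n}"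
    using assms mirror_permutes by (intro permutes_compose)
  have "L1_dist n (mirror \<circ> \<sigma> \<circ> mirror) id = L1_dist n \<sigma> id"
    unfolding L1_dist_def
  proof (rule sum.reindex_bij_witness[of _ mirror mirror])
    fix j assume j: "j \<in> {1..n}"
    then have "\<sigma> (mirror j) \<in> {1..n}" "mirror j \<in> {1..n}"
      using assms mirror_permutes by (simp_all only: permutes_in_image)
    then show "\<bar>real (\<sigma> (mirror j)) - real (id (mirror j))\<bar> =
        \<bar>real ((mirror \<circ> \<sigma> \<circ> mirror) j) - real (id j)\<bar>"
      using j by (auto simp: mirror_def of_nat_diff)
  qed (use mirror_permutes in \<open>simp_all only: permutes_in_image mirror_mirror\<close>)
  then show ?thesis
    using assms perm by (simp add: pmf_mallows)
qed

lemma E_mirror: "E (\<lambda>\<sigma>. f (mirror \<circ> \<sigma> \<circ> mirror)) = E f"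
  unfolding E_sum
  by (rule sum.reindex_bij_witness[of _ "\<lambda>\<sigma>. mirror \<circ> \<sigma> \<circ> mirror" "\<lambda>\<sigma>. mirror \<circ> \<sigma> \<circ> mirror"])
    (use mirror_permutes in \<open>auto simp: fun_eq_iff pr_mirror intro!: permutes_compose\<close>)

lemma orbit_mirror: "orbit (mirror \<circ> \<sigma> \<circ> mirror) (mirror s) = mirror ` orbit \<sigma> s"
proof -
  have *: "mirror x \<in> orbit (mirror \<circ> \<sigma> \<circ> mirror) (mirror s)" if "x \<in> orbit \<sigma> s" for x \<sigma> s
    using that
  proof induction
    case base
    show ?case using orbit.base[of "mirror \<circ> \<sigma> \<circ> mirror" "mirror s"] by (simp add: comp_def)
  next
    case (step x)
    then show ?case using orbit.step[of "mirror x" "mirror \<circ> \<sigma> \<circ> mirror" "mirror s"] by (simp add: comp_def)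
  qed
  show ?thesis
  proof (intro equalityI subsetI)
    fix y assume "y \<in> orbit (mirror \<circ> \<sigma> \<circ> mirror) (mirror s)"
    from *[OF this] have "mirror y \<in> orbit \<sigma> s" by (simp add: comp_def)
    then show "y \<in> mirror ` orbit \<sigma> s" by (metis imageI mirror_mirror)
  qed (use * in auto)
qed

lemma expected_Min_cycle:
  assumes s: "s \<in> {1..n}"
  shows "E (\<lambda>\<sigma>. real s - real (Min (orbit \<sigma> s)))
    = E (\<lambda>\<sigma>. real (Max (orbit \<sigma> (n + 1 - s))) - real (n + 1 - s))"
proof -
  have "E (\<lambda>\<sigma>. real (Max (orbit \<sigma> (n + 1 - s))) - real (n + 1 - s))
     = E (\<lambda>\<sigma>. real (Max (orbit (mirror \<circ> \<sigma> \<circ> mirror) (n + 1 - s))) - real (n + 1 - s))"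
    by (rule E_mirror[symmetric])
  also have "\<dots> = E (\<lambda>\<sigma>. real s - real (Min (orbit \<sigma> s)))"
  proof (rule E_cong)
    fix \<sigma> assume \<sigma>: "\<sigma> permutes {1..n}"
    note c = cycle_facts[OF \<sigma> s]
    have ms: "mirror s = n + 1 - s" using s by (simp add: mirror_def)
    have mem: "Min (orbit \<sigma> s) \<in> orbit \<sigma> s" using c by (intro Min_in)
    then have "Min (orbit \<sigma> s) \<in> {1..n}" using c(4) by blast
    moreover have "Max (mirror ` orbit \<sigma> s) = mirror (Min (orbit \<sigma> s))"
    proof (rule Max_eqI)
      fix y assume "y \<in> mirror ` orbit \<sigma> s"
      then obtain x where x: "x \<in> orbit \<sigma> s" "y = mirror x" by blast
      then have "Min (orbit \<sigma> s) \<le> x" "x \<in> {1..n}" using c by auto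
      then show "y \<le> mirror (Min (orbit \<sigma> s))"
        using x(2) calculation by (auto simp: mirror_def)
    qed (use c mem in auto)
    ultimately show "real (Max (orbit (mirror \<circ> \<sigma> \<circ> mirror) (n + 1 - s))) - real (n + 1 - s) =
        real s - real (Min (orbit \<sigma> s))"
      using s unfolding ms[symmetric] orbit_mirror by (auto simp: mirror_def of_nat_diff)
  qed
  finally show ?thesis by simp
qed

section \<open>Lower bounds\<close>

lemma gain_ge: "- 2 * \<bar>real i - real j\<bar> \<le> gain \<sigma> i j"
proof -
  have tri: "\<bar>a - y\<bar> \<le> \<bar>a - x\<bar> + \<bar>x - y\<bar>" for a x y :: real
    by simp
  have "\<bar>real (\<sigma> i) - real j\<bar> \<le> \<bar>real (\<sigma> i) - real i\<bar> + \<bar>real i - real j\<bar>"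
    "\<bar>real (\<sigma> j) - real i\<bar> \<le> \<bar>real (\<sigma> j) - real j\<bar> + \<bar>real i - real j\<bar>"
    using tri[of "real (\<sigma> i)" "real j" "real i"] tri[of "real (\<sigma> j)" "real i" "real j"]
    by (simp_all add: abs_minus_commute)
  then show ?thesis by (simp add: gain_def)
qed

text \<open>
  A fixed point \<open>s\<close> can be exchanged with a neighbour \<open>t\<close>, which increases the \<open>L\<^sup>1\<close> distance by at
  most \<open>2\<close>.
\<close>

lemma prob_moved:
  assumes s: "s \<in> {1..n}" and n: "2 \<le> n"
  shows "q / 2 \<le> E (\<lambda>\<sigma>. of_bool (\<sigma> s \<noteq> s))"
proof -
  obtain t where t: "t \<in> {1..n}" "\<bar>real s - real t\<bar> = 1"
  proof (cases "s = n")
    case True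
    show thesis by (rule that[of "n - 1"]) (use n True in \<open>auto simp: of_nat_diff\<close>)
  next
    case False
    show thesis by (rule that[of "s + 1"]) (use s False in auto)
  qed
  define x where "x = E (\<lambda>\<sigma>. of_bool (\<sigma> s \<noteq> s))"
  have "E (\<lambda>\<sigma>. 1 * real (card (if \<sigma> s = s then {(s, t)} else {})))
      \<le> E (\<lambda>\<sigma>. exp (2 * \<beta>) * of_bool (\<sigma> s \<noteq> s))"
  proof (rule exchange_bound[where R = "\<lambda>\<sigma>. if \<sigma> s \<noteq> s then {(s, t)} else {}" and g = "\<lambda>_ _ _. exp (2 * \<beta>)"])
    fix \<sigma> i j assume \<sigma>: "\<sigma> permutes {1..n}" and "(i, j) \<in> (if \<sigma> s = s then {(s, t)} else {})"
    then have ij: "i = s" "j = t" "\<sigma> s = s" by (auto split: if_splits)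
    have "t \<noteq> s" using t(2) by auto
    then have "\<sigma> t \<noteq> s" using ij(3) permutes_inj[OF \<sigma>] by (metis injD)
    then show "(i, j) \<in> (if (\<sigma> \<circ> transp i j) s \<noteq> s then {(s, t)} else {})"
      by (simp add: ij)
    have "- 2 \<le> gain \<sigma> i j" using gain_ge[of i j \<sigma>] t(2) ij by simp
    then show "exp (- \<beta> * gain \<sigma> i j) * 1 \<le> exp (2 * \<beta>)"
      using mult_left_mono[of "-2" "gain \<sigma> i j" \<beta>] \<beta>_pos by simp
  qed (use s t in auto)
  also have "E (\<lambda>\<sigma>. 1 * real (card (if \<sigma> s = s then {(s, t)} else {}))) = E (\<lambda>\<sigma>. 1 - of_bool (\<sigma> s \<noteq> s))"
    by (rule E_cong) simp
  also have "\<dots> = 1 - x"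
    unfolding x_def by (subst Bochner_Integration.integral_diff) (auto intro: integrable_E)
  also have "E (\<lambda>\<sigma>. exp (2 * \<beta>) * of_bool (\<sigma> s \<noteq> s)) = exp (2 * \<beta>) * x"
    unfolding x_def by (rule E_cmult)
  finally have "1 - x \<le> exp (2 * \<beta>) * x" .
  then have "q * (1 - x) \<le> q * (exp (2 * \<beta>) * x)"
    using q_bounds by (intro mult_left_mono) auto
  also have "\<dots> = x" by (simp add: q_def mult.assoc[symmetric] flip: exp_add)
  finally have "q \<le> (1 + q) * x" by (simp add: algebra_simps)
  moreover have "0 \<le> x" unfolding x_def by (rule E_nonneg) simp
  then have "(1 + q) * x \<le> 2 * x" using q_bounds by (intro mult_right_mono) auto
  ultimately show ?thesis unfolding x_def[symmetric] by simp
qed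

text \<open>
  While the flux is below \<open>W / 2\<close>, each of the windows of length \<open>W\<close> on the two sides of the cut contains
  at least \<open>W / 2\<close> points whose image stays on the same side. Exchanging a point \<open>i\<close> of the left window with
  a point \<open>j\<close> of the right one raises the flux by one and costs at most a factor
  \<open>exp (4 * \<beta> * W) \<le> exp 4\<close>, while the new permutation has only \<open>(flux)\<^sup>2\<close> candidates for \<open>(i, j)\<close>.
\<close>

lemma inverse_second_moment_flux:
  assumes W: "1 \<le> W" "W \<le> k" "k + W \<le> n" and \<beta>W: "\<beta> * real W \<le> 1"
  shows "E (\<lambda>\<sigma>. 1 / (real (flux k \<sigma>) + 1)\<^sup>2) \<le> (4 + 4 * exp 4) / (real W)\<^sup>2"
proof -
  define f where "f \<sigma> = (if 2 * (flux k \<sigma> + 1) \<le> W then 1 / (real (flux k \<sigma>) + 1)\<^sup>2 else 0)" for \<sigma>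
  define A where "A \<sigma> = {i \<in> {Suc k - W..k}. \<sigma> i \<le> k}" for \<sigma> :: "nat \<Rightarrow> nat"
  define B where "B \<sigma> = {j \<in> {Suc k..k + W}. k < \<sigma> j}" for \<sigma> :: "nat \<Rightarrow> nat"
  define S where "S \<sigma> = {j. k < j \<and> \<sigma> j \<le> k}" for \<sigma> :: "nat \<Rightarrow> nat"
  have main: "E (\<lambda>\<sigma>. f \<sigma> * real (card (A \<sigma> \<times> B \<sigma>))) \<le> E (\<lambda>_. exp 4)"
  proof (rule exchange_bound[where R = "\<lambda>\<sigma>. outs k \<sigma> \<times> S \<sigma>" and g = "\<lambda>\<sigma> i j. exp 4 / (real (flux k \<sigma>))\<^sup>2"])
    fix \<sigma> assume \<sigma>: "\<sigma> permutes {1..n}"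
    show "A \<sigma> \<times> B \<sigma> \<subseteq> {1..n} \<times> {1..n}"
      using W by (auto simp: A_def B_def)
    show "outs k \<sigma> \<times> S \<sigma> \<subseteq> {1..n} \<times> {1..n}"
      unfolding S_def by (intro Sigma_mono outs_subset sources_subset \<sigma>)
    show "(\<Sum>(i, j)\<in>outs k \<sigma> \<times> S \<sigma>. exp 4 / (real (flux k \<sigma>))\<^sup>2) \<le> exp 4"
      by (simp add: card_cartesian_product S_def card_sources[OF \<sigma>] flux_def[symmetric] power2_eq_square)
  next
    fix \<sigma> i j assume \<sigma>: "\<sigma> permutes {1..n}" and "(i, j) \<in> A \<sigma> \<times> B \<sigma>"
    then have i: "Suc k \<le> i + W" "i \<le> k" "\<sigma> i \<le> k" and j: "k < j" "j \<le> k + W" "k < \<sigma> j"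
      by (auto simp: A_def B_def)
    let ?\<tau> = "\<sigma> \<circ> transp i j"
    have \<tau>: "?\<tau> i = \<sigma> j" "?\<tau> j = \<sigma> i" by auto
    show "(i, j) \<in> outs k ?\<tau> \<times> S ?\<tau>"
      using i j by (simp add: outs_def S_def)
    have "outs k ?\<tau> = insert i (outs k \<sigma>)"
      using i j by (auto simp: outs_def Transposition.transpose_def)
    moreover have "i \<notin> outs k \<sigma>" using i by (simp add: outs_def)
    ultimately have fl: "flux k ?\<tau> = flux k \<sigma> + 1"
      by (simp add: flux_def finite_outs)
    have "\<bar>real i - real j\<bar> \<le> 2 * real W" using i j by linarith
    then have "- 4 * real W \<le> - 2 * \<bar>real i - real j\<bar>" by simp
    then have "- 4 * real W \<le> gain \<sigma> i j" using gain_ge by (rule order_trans)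
    then have "\<beta> * (- 4 * real W) \<le> \<beta> * gain \<sigma> i j" using \<beta>_pos by (intro mult_left_mono) auto
    then have e: "exp (- \<beta> * gain \<sigma> i j) \<le> exp 4" using \<beta>W by simp
    have "f \<sigma> \<le> 1 / (real (flux k ?\<tau>))\<^sup>2" by (simp add: f_def fl add.commute)
    moreover have "0 \<le> f \<sigma>" by (simp add: f_def)
    ultimately have "exp (- \<beta> * gain \<sigma> i j) * f \<sigma> \<le> exp 4 * (1 / (real (flux k ?\<tau>))\<^sup>2)"
      using e by (intro mult_mono) auto
    then show "exp (- \<beta> * gain \<sigma> i j) * f \<sigma> \<le> exp 4 / (real (flux k ?\<tau>))\<^sup>2" by simp
  qed simp_all
  have "E (\<lambda>\<sigma>. 1 / (real (flux k \<sigma>) + 1)\<^sup>2) \<le>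
      E (\<lambda>\<sigma>. 4 / (real W)\<^sup>2 * (f \<sigma> * real (card (A \<sigma> \<times> B \<sigma>))) + 4 / (real W)\<^sup>2)"
  proof (rule E_mono)
    fix \<sigma> assume \<sigma>: "\<sigma> permutes {1..n}"
    let ?d = "real (flux k \<sigma>)"
    show "1 / (?d + 1)\<^sup>2 \<le> 4 / (real W)\<^sup>2 * (f \<sigma> * real (card (A \<sigma> \<times> B \<sigma>))) + 4 / (real W)\<^sup>2"
    proof (cases "2 * (flux k \<sigma> + 1) \<le> W")
      case True
      have "card {Suc k - W..k} \<le> card (A \<sigma> \<union> outs k \<sigma>)"
        using finite_outs by (intro card_mono) (auto simp: A_def outs_def)
      also have "\<dots> \<le> card (A \<sigma>) + flux k \<sigma>" unfolding flux_def by (rule card_Un_le)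
      finally have cA: "W / 2 \<le> real (card (A \<sigma>))" using W True by simp
      have "card {Suc k..k + W} \<le> card (B \<sigma> \<union> S \<sigma>)"
        using finite_sources[OF \<sigma>, of k] by (intro card_mono) (auto simp: B_def S_def)
      also have "\<dots> \<le> card (B \<sigma>) + flux k \<sigma>"
        using card_Un_le[of "B \<sigma>" "S \<sigma>"] by (simp add: S_def card_sources[OF \<sigma>])
      finally have cB: "W / 2 \<le> real (card (B \<sigma>))" using True by simp
      have "(W / 2) * (W / 2) \<le> real (card (A \<sigma>)) * real (card (B \<sigma>))"
        using cA cB by (intro mult_mono) auto
      then have "1 \<le> 4 / (real W)\<^sup>2 * real (card (A \<sigma> \<times> B \<sigma>))"
        using W(1) by (simp add: card_cartesian_product field_simps power2_eq_square)
      from mult_left_mono[OF this, of "f \<sigma>"]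
      have "f \<sigma> \<le> 4 / (real W)\<^sup>2 * (f \<sigma> * real (card (A \<sigma> \<times> B \<sigma>)))"
        by (simp add: f_def True mult_ac)
      moreover have "1 / (?d + 1)\<^sup>2 = f \<sigma>" using True by (simp add: f_def)
      moreover have "0 \<le> 4 / (real W)\<^sup>2" by simp
      ultimately show ?thesis by linarith
    next
      case False
      then have "real W \<le> real (2 * (flux k \<sigma> + 1))" by (intro of_nat_mono) linarith
      then have "real W \<le> 2 * (?d + 1)" by simp
      then have "(real W)\<^sup>2 \<le> (2 * (?d + 1))\<^sup>2" by (intro power_mono) auto
      also have "\<dots> = 4 * (?d + 1)\<^sup>2" by (rule power_mult_distrib[THEN trans]) simp
      finally have "1 / (?d + 1)\<^sup>2 \<le> 4 / (real W)\<^sup>2"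
        using W(1) by (simp add: field_simps)
      then show ?thesis using False by (simp add: f_def)
    qed
  qed
  also have "\<dots> = 4 / (real W)\<^sup>2 * E (\<lambda>\<sigma>. f \<sigma> * real (card (A \<sigma> \<times> B \<sigma>))) + 4 / (real W)\<^sup>2"
    by (simp only: E_add E_cmult E_const)
  also have "\<dots> \<le> 4 / (real W)\<^sup>2 * exp 4 + 4 / (real W)\<^sup>2"
    using main by (intro add_right_mono mult_left_mono) auto
  also have "\<dots> = (4 + 4 * exp 4) / (real W)\<^sup>2"
    by (simp add: add_divide_distrib)
  finally show ?thesis .
qed

text \<open>
  If the cycle of \<open>s\<close> stays to the left of the cut, exchanging the images of \<open>s\<close> and of any exit \<open>i\<close>
  sends \<open>s\<close> over the cut. Since \<open>s\<close> is within distance \<open>W\<close> of the cut, this loses at most a factor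
  \<open>exp 2\<close>, and it gains weight if \<open>i\<close> and its new image both lie far to the left of \<open>s\<close>; so the number
  of relevant \<open>i\<close> is \<open>O(W + K)\<close>, besides being at most \<open>n\<close>.
\<close>

lemma join_across_cut:
  assumes s: "s \<in> {1..n}" and W: "\<beta> * real W \<le> 1" and k: "k = s + W" "k \<le> n"
  shows "E (\<lambda>\<sigma>. of_bool (\<not> crosses k \<sigma> s) * real (flux k \<sigma>))
    \<le> exp 2 * min (real n) (2 * (real W + K)) * E (\<lambda>\<sigma>. of_bool (crosses k \<sigma> s))"
proof -
  define M where "M = min (real n) (2 * (real W + K))"
  define A where "A \<sigma> = {i \<in> {1..k}. \<sigma> i \<le> k}" for \<sigma> :: "nat \<Rightarrow> nat"
  define Q where "Q \<sigma> = (if \<not> crosses k \<sigma> s then {s} \<times> outs k \<sigma> else {})" for \<sigma>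
  define R where "R \<sigma> = (if crosses k \<sigma> s then {s} \<times> A \<sigma> else {})" for \<sigma>
  have sum_le: "(\<Sum>i\<in>A \<sigma>. q ^ (s - max i (\<sigma> i))) \<le> M" if \<sigma>: "\<sigma> permutes {1..n}" for \<sigma>
  proof -
    have fA: "finite (A \<sigma>)" by (simp add: A_def)
    have "(\<Sum>i\<in>A \<sigma>. q ^ (s - max i (\<sigma> i))) \<le> real (card (A \<sigma>)) * 1"
      by (rule sum_bounded_above) (rule q_pow_le_one)
    also have "card (A \<sigma>) \<le> card {1..n}"
      using k by (intro card_mono) (auto simp: A_def)
    finally have 1: "(\<Sum>i\<in>A \<sigma>. q ^ (s - max i (\<sigma> i))) \<le> n" by simp
    \<comment> \<open>The subtraction truncates: the \<open>W\<close> points between \<open>s\<close> and the cut contribute \<open>1\<close> each.\<close>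
    have tot: "(\<Sum>i = 1..k. q ^ (s - i)) \<le> W + K"
    proof -
      have eq: "{1..k} = {1..s} \<union> {Suc s..k}" using s k by auto
      have "(\<Sum>i = 1..k. q ^ (s - i)) = (\<Sum>i = 1..s. q ^ (s - i)) + (\<Sum>i = Suc s..k. q ^ (s - i))"
        unfolding eq by (rule sum.union_disjoint) auto
      moreover have "(\<Sum>i = 1..s. q ^ (s - i)) \<le> K"
        by (rule sum_q_pow_inj_le) (auto intro!: inj_onI)
      moreover have "(\<Sum>i = Suc s..k. q ^ (s - i)) = W"
        using k by simp
      ultimately show ?thesis by simp
    qed
    have "(\<Sum>i\<in>A \<sigma>. q ^ (s - max i (\<sigma> i))) \<le> (\<Sum>i\<in>A \<sigma>. q ^ (s - i) + q ^ (s - \<sigma> i))"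
      using q_pow_nonneg by (intro sum_mono) (auto simp: max_def)
    also have "\<dots> = (\<Sum>i\<in>A \<sigma>. q ^ (s - i)) + (\<Sum>i\<in>\<sigma> ` A \<sigma>. q ^ (s - i))"
      using permutes_inj[OF \<sigma>] by (simp add: sum.distrib sum.reindex inj_on_subset)
    also have "\<dots> \<le> (\<Sum>i = 1..k. q ^ (s - i)) + (\<Sum>i = 1..k. q ^ (s - i))"
    proof (intro add_mono sum_mono2)
      show "\<sigma> ` A \<sigma> \<subseteq> {1..k}"
      proof
        fix v assume "v \<in> \<sigma> ` A \<sigma>"
        then obtain i where "i \<in> A \<sigma>" "v = \<sigma> i" by blast
        then have i: "i \<in> {1..n}" "v = \<sigma> i" "\<sigma> i \<le> k" using k by (auto simp: A_def)
        then show "v \<in> {1..k}" using permutes_in_image[OF \<sigma>, of i] by auto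
      qed
    qed (auto simp: A_def q_pow_nonneg)
    finally show ?thesis using 1 tot by (simp add: M_def)
  qed
  have "E (\<lambda>\<sigma>. 1 * real (card (Q \<sigma>))) \<le> E (\<lambda>\<sigma>. exp 2 * M * of_bool (crosses k \<sigma> s))"
  proof (rule exchange_bound[where R = R and g = "\<lambda>\<sigma> a i. exp 2 * q ^ (s - max i (\<sigma> i))"])
    fix \<sigma> assume \<sigma>: "\<sigma> permutes {1..n}"
    show "Q \<sigma> \<subseteq> {1..n} \<times> {1..n}"
      using outs_subset[OF \<sigma>, of k] s by (auto simp: Q_def)
    show "R \<sigma> \<subseteq> {1..n} \<times> {1..n}"
      using s k by (auto simp: R_def A_def)
    show "(\<Sum>(a, i)\<in>R \<sigma>. exp 2 * q ^ (s - max i (\<sigma> i))) \<le> exp 2 * M * of_bool (crosses k \<sigma> s)"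
      using sum_le[OF \<sigma>] by (simp add: R_def sum.cartesian_product[symmetric] sum_distrib_left[symmetric])
  next
    fix \<sigma> and a i :: nat
    show "0 \<le> exp 2 * q ^ (s - max i (\<sigma> i))" using q_pow_nonneg by simp
  next
    fix \<sigma> a i assume \<sigma>: "\<sigma> permutes {1..n}" and "(a, i) \<in> Q \<sigma>"
    then have nc: "\<not> crosses k \<sigma> s" and a: "a = s" and i: "i \<in> outs k \<sigma>"
      by (auto simp: Q_def split: if_splits)
    have \<sigma>s: "\<sigma> s \<le> k" using nc orbit.base[of \<sigma> s] by (force simp: crosses_def)
    have i': "i \<in> {1..n}" "i \<le> k" "k < \<sigma> i"
      using subsetD[OF outs_subset[OF \<sigma>] i] i by (auto simp: outs_def)
    let ?\<tau> = "\<sigma> \<circ> transp s i"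
    have \<tau>: "?\<tau> s = \<sigma> i" "?\<tau> i = \<sigma> s" by auto
    have "crosses k ?\<tau> s"
      using orbit.base[of ?\<tau> s] i'(3) \<tau>(1) by (auto simp: crosses_def)
    then show "(a, i) \<in> R (\<sigma> \<circ> transp a i)"
      using a i' \<tau> \<sigma>s by (simp add: R_def A_def)
    have "2 * real (s - max i (\<sigma> s)) - 2 * real W \<le> gain \<sigma> s i"
    proof -
      have g: "gain \<sigma> s i = \<bar>real (\<sigma> s) - real s\<bar> + real s - real i - \<bar>real (\<sigma> s) - real i\<bar>"
        using i' k unfolding gain_def by simp
      have iW: "real i \<le> real s + real W" using i' k by simp
      show ?thesis
      proof (cases "max i (\<sigma> s) \<le> s")
        case True
        then have "real (s - max i (\<sigma> s)) = real s - max (real i) (real (\<sigma> s))"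
          by (simp add: of_nat_diff)
        then show ?thesis using True unfolding g by (simp add: max_def split: if_splits)
      next
        case False
        then have "s - max i (\<sigma> s) = 0" by linarith
        then have "real (s - max i (\<sigma> s)) = 0" by simp
        then show ?thesis using iW False unfolding g by (simp add: max_def split: if_splits)
      qed
    qed
    from mult_left_mono[OF this, of \<beta>]
    have "- \<beta> * gain \<sigma> s i \<le> 2 * (\<beta> * real W) + real (s - max i (\<sigma> s)) * (- 2 * \<beta>)"
      using \<beta>_pos by (simp add: algebra_simps)
    also have "\<dots> \<le> 2 + real (s - max i (\<sigma> s)) * (- 2 * \<beta>)"
      using W by simp
    finally have "exp (- \<beta> * gain \<sigma> s i) \<le> exp (2 + real (s - max i (\<sigma> s)) * (- 2 * \<beta>))"
      by simp
    also have "\<dots> = exp 2 * q ^ (s - max i (\<sigma> s))"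
      unfolding exp_add q_def by (simp only: exp_of_nat_mult)
    finally show "exp (- \<beta> * gain \<sigma> a i) * 1 \<le>
        exp 2 * q ^ (s - max i ((\<sigma> \<circ> transp a i) i))"
      using a \<tau> by simp
  qed
  moreover have "E (\<lambda>\<sigma>. 1 * real (card (Q \<sigma>))) = E (\<lambda>\<sigma>. of_bool (\<not> crosses k \<sigma> s) * real (flux k \<sigma>))"
    by (intro E_cong) (simp add: Q_def flux_def card_cartesian_product)
  ultimately show ?thesis
    by (simp only: E_cmult M_def)
qed


section \<open>The expected diameter of a cycle\<close>

abbreviation diam :: "(nat \<Rightarrow> nat) \<Rightarrow> nat \<Rightarrow> real" where
  "diam \<sigma> s \<equiv> real (Max (orbit \<sigma> s)) - real (Min (orbit \<sigma> s))"

lemma expected_diam: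
  assumes "s \<in> {1..n}"
  shows "E (\<lambda>\<sigma>. diam \<sigma> s) = E (\<lambda>\<sigma>. real (Max (orbit \<sigma> s)) - real s)
    + E (\<lambda>\<sigma>. real (Max (orbit \<sigma> (n + 1 - s))) - real (n + 1 - s))"
  unfolding expected_Min_cycle[OF assms, symmetric] E_add[symmetric] by simp

lemma Max_cycle_ge_start:
  assumes "s \<in> {1..n}"
  shows "0 \<le> E (\<lambda>\<sigma>. real (Max (orbit \<sigma> s)) - real s)"
  using cycle_facts[OF _ assms] by (intro E_nonneg) auto

lemma exp_2_le: "exp 2 \<le> (9 :: real)"
proof -
  have "exp 2 = (exp 1 :: real) ^ 2" by (simp flip: exp_of_nat_mult)
  also have "\<dots> \<le> 3 ^ 2" by (intro power_mono exp_le) simp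
  finally show ?thesis by simp
qed

lemma exp_4_le: "exp 4 \<le> (81 :: real)"
proof -
  have "exp 4 = (exp 1 :: real) ^ 4" by (simp flip: exp_of_nat_mult)
  also have "\<dots> \<le> 3 ^ 4" by (intro power_mono exp_le) simp
  finally show ?thesis by simp
qed

lemma q_ge:
  assumes "\<beta> \<le> 1"
  shows "1 \<le> 9 * q"
proof -
  have "1 = exp 2 * exp (- 2 :: real)" by (simp flip: exp_add)
  also have "\<dots> \<le> 9 * q"
    using assms exp_2_le unfolding q_def by (intro mult_mono) auto
  finally show ?thesis .
qed

lemma K_le_inverse:
  assumes "\<beta> \<le> 1"
  shows "K \<le> 3 / (2 * \<beta>)"
proof -
  have "q \<le> 1 / (1 + 2 * \<beta>)"
    using exp_ge_add_one_self[of "2 * \<beta>"] \<beta>_pos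
    by (simp add: q_def exp_minus field_simps)
  then have "2 * \<beta> / (1 + 2 * \<beta>) \<le> 1 - q"
    using \<beta>_pos by (simp add: field_simps)
  then have "K \<le> 1 / (2 * \<beta> / (1 + 2 * \<beta>))"
    unfolding K_def using \<beta>_pos by (intro divide_left_mono) (auto simp: q_bounds)
  also have "\<dots> \<le> 3 / (2 * \<beta>)"
    using \<beta>_pos assms by (simp add: field_simps)
  finally show ?thesis .
qed

lemma K_le_2:
  assumes "1 \<le> \<beta>"
  shows "K \<le> 2"
proof -
  have "2 \<le> exp (2 * \<beta>)" using exp_ge_add_one_self[of "2 * \<beta>"] assms by linarith
  then have "q \<le> 1 / 2" by (simp add: q_def exp_minus field_simps)
  then show ?thesis using q_bounds by (simp add: K_def field_simps)
qed

lemma expected_diam_le: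
  assumes s: "s \<in> {1..n}"
  shows "E (\<lambda>\<sigma>. diam \<sigma> s) \<le> 3328 * min (q * max (1 / \<beta>\<^sup>2) 1) (real n - 1)"
proof -
  have s': "n + 1 - s \<in> {1..n}" using s by auto
  define m where "m = min 1 (4 * q * K\<^sup>2)"
  have bound: "E (\<lambda>\<sigma>. diam \<sigma> s) \<le> 52 * K\<^sup>2 * m"
    using expected_Max_cycle_le[OF s] expected_Max_cycle_le[OF s']
    unfolding expected_diam[OF s] m_def by linarith
  have "52 * K\<^sup>2 * m \<le> 3328 * (q * max (1 / \<beta>\<^sup>2) 1)"
  proof (cases "\<beta> \<le> 1")
    case True
    have "K\<^sup>2 \<le> (3 / (2 * \<beta>))\<^sup>2"
      using K_ge_1 by (intro power_mono K_le_inverse True) auto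
    then have "K\<^sup>2 \<le> 9 / 4 * (1 / \<beta>\<^sup>2)" by (simp add: power_divide power_mult_distrib)
    moreover have "52 * K\<^sup>2 * m \<le> 52 * K\<^sup>2 * 1"
      by (intro mult_left_mono) (auto simp: m_def)
    ultimately have "52 * K\<^sup>2 * m \<le> 117 * (1 / \<beta>\<^sup>2)" by simp
    also have "\<dots> \<le> 117 * (1 / \<beta>\<^sup>2) * (9 * q)"
      using mult_left_mono[OF q_ge[OF True], of "117 * (1 / \<beta>\<^sup>2)"] by simp
    also have "\<dots> = 1053 * (q * (1 / \<beta>\<^sup>2))" by simp
    also have "\<dots> \<le> 3328 * (q * max (1 / \<beta>\<^sup>2) 1)"
      using q_bounds by (intro mult_mono) auto
    finally show ?thesis .
  next
    case False
    have "K ^ 4 \<le> 2 ^ 4" using K_ge_1 K_le_2 False by (intro power_mono) auto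
    have "52 * K\<^sup>2 * m \<le> 52 * K\<^sup>2 * (4 * q * K\<^sup>2)"
      by (intro mult_left_mono) (auto simp: m_def)
    also have "\<dots> = 208 * q * K ^ 4" by (simp add: power2_eq_square power4_eq_xxxx)
    also have "\<dots> \<le> 208 * q * 2 ^ 4"
      using \<open>K ^ 4 \<le> 2 ^ 4\<close> q_bounds by (intro mult_left_mono) auto
    also have "\<dots> = 3328 * (q * 1)" by simp
    also have "\<dots> \<le> 3328 * (q * max (1 / \<beta>\<^sup>2) 1)"
      using q_bounds by (intro mult_left_mono) auto
    finally show ?thesis .
  qed
  with bound have 1: "E (\<lambda>\<sigma>. diam \<sigma> s) \<le> 3328 * (q * max (1 / \<beta>\<^sup>2) 1)" by linarith
  have "E (\<lambda>\<sigma>. diam \<sigma> s) \<le> E (\<lambda>_. real n - 1)"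
  proof (rule E_mono)
    fix \<sigma> assume "\<sigma> permutes {1..n}"
    note c = cycle_facts[OF this s]
    have "Max (orbit \<sigma> s) \<in> {1..n}" "Min (orbit \<sigma> s) \<in> {1..n}"
      using c Max_in[OF c(1,2)] Min_in[OF c(1,2)] by blast+
    then show "diam \<sigma> s \<le> real n - 1" by auto
  qed
  moreover have "1 \<le> n" using s by simp
  ultimately have 2: "E (\<lambda>\<sigma>. diam \<sigma> s) \<le> 3328 * (real n - 1)" by simp
  show ?thesis using 1 2 by (simp add: min_def)
qed

text \<open>
  Write \<open>D\<close> for the flux at the cut \<open>s + W\<close>. Exchanges bound \<open>D\<close> in mean on the event that the cycle
  does not cross, while \<open>D\<close> is rarely much smaller than \<open>W\<close>. Both are combined by
  \<open>1 \<le> y + 1 / y\<^sup>2\<close> for \<open>y = 40 * (D + 1) / W\<close>. The number \<open>40\<close> makes the contribution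
  \<open>328 / 40\<^sup>2\<close> of the second term at most \<open>1 / 4\<close>, where \<open>4 + 4 * exp 4 \<le> 328\<close>; the condition
  \<open>160 \<le> W\<close> does the same for the error \<open>40 / W\<close>. For the crossing probability \<open>p\<close> there remains
  \<open>1 - p \<le> 5760 * p + 1 / 2\<close>.
\<close>

lemma prob_crosses_ge:
  assumes s: "s \<in> {1..n}" and W: "160 \<le> W" "\<beta> * real W \<le> 1" and n: "s + 2 * W \<le> n"
    and M: "min (real n) (2 * (real W + K)) \<le> 16 * real W"
  shows "1 / 12000 \<le> E (\<lambda>\<sigma>. of_bool (crosses (s + W) \<sigma> s))"
proof -
  define k where "k = s + W"
  define p where "p = E (\<lambda>\<sigma>. of_bool (crosses k \<sigma> s))"
  define nc where "nc \<sigma> = (of_bool (\<not> crosses k \<sigma> s) :: real)" for \<sigma>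
  have p0: "0 \<le> p" unfolding p_def by (rule E_nonneg) simp
  have Wpos: "0 < real W" using W by simp
  have inv2: "E (\<lambda>\<sigma>. 1 / (real (flux k \<sigma>) + 1)\<^sup>2) \<le> 328 / (real W)\<^sup>2"
  proof -
    have "E (\<lambda>\<sigma>. 1 / (real (flux k \<sigma>) + 1)\<^sup>2) \<le> (4 + 4 * exp 4) / (real W)\<^sup>2"
      using W n by (intro inverse_second_moment_flux) (auto simp: k_def)
    also have "\<dots> \<le> 328 / (real W)\<^sup>2"
      using exp_4_le by (intro divide_right_mono) auto
    finally show ?thesis .
  qed
  have join: "E (\<lambda>\<sigma>. nc \<sigma> * real (flux k \<sigma>)) \<le> 144 * real W * p"
  proof -
    have "E (\<lambda>\<sigma>. nc \<sigma> * real (flux k \<sigma>)) \<le> exp 2 * min (real n) (2 * (real W + K)) * p"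
      unfolding nc_def p_def using n by (intro join_across_cut s W(2)) (auto simp: k_def)
    also have "\<dots> \<le> 9 * (16 * real W) * p"
      using exp_2_le M K_ge_1 p0 by (intro mult_right_mono mult_mono) auto
    finally show ?thesis by simp
  qed
  have nc_E: "E nc = 1 - p"
  proof -
    have "E nc + p = E (\<lambda>\<sigma>. nc \<sigma> + of_bool (crosses k \<sigma> s))" by (simp only: E_add p_def)
    also have "\<dots> = E (\<lambda>_. 1)" by (rule E_cong) (simp add: nc_def)
    finally show ?thesis by simp
  qed
  have "E nc \<le> E (\<lambda>\<sigma>. 40 / real W * (nc \<sigma> * real (flux k \<sigma>)) + (40 / real W * nc \<sigma>
      + (real W)\<^sup>2 / 1600 * (1 / (real (flux k \<sigma>) + 1)\<^sup>2)))"
  proof (rule E_mono)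
    fix \<sigma>
    define y where "y = 40 / real W * (real (flux k \<sigma>) + 1)"
    have y: "0 < y" using Wpos by (simp add: y_def)
    have "1 \<le> y + 1 / y\<^sup>2"
    proof (cases "1 \<le> y")
      case False
      then have "y\<^sup>2 \<le> 1" using y by (simp add: power_le_one)
      then show ?thesis using y by (simp add: add_increasing)
    qed (simp add: add_increasing2)
    then have "nc \<sigma> * 1 \<le> nc \<sigma> * y + 1 / y\<^sup>2"
      using y by (simp add: nc_def)
    also have "1 / y\<^sup>2 = (real W)\<^sup>2 / 1600 * (1 / (real (flux k \<sigma>) + 1)\<^sup>2)"
      by (simp add: y_def power_divide power_mult_distrib del: distrib_left_numeral)
    also have "nc \<sigma> * y = 40 / real W * (nc \<sigma> * real (flux k \<sigma>)) + 40 / real W * nc \<sigma>"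
      by (simp add: y_def algebra_simps add_divide_distrib)
    finally show "nc \<sigma> \<le> 40 / real W * (nc \<sigma> * real (flux k \<sigma>)) + (40 / real W * nc \<sigma>
      + (real W)\<^sup>2 / 1600 * (1 / (real (flux k \<sigma>) + 1)\<^sup>2))"
      by simp
  qed
  also have "\<dots> = 40 / real W * E (\<lambda>\<sigma>. nc \<sigma> * real (flux k \<sigma>)) + (40 / real W * E nc
      + (real W)\<^sup>2 / 1600 * E (\<lambda>\<sigma>. 1 / (real (flux k \<sigma>) + 1)\<^sup>2))"
    by (simp only: E_add E_cmult)
  also have "\<dots> \<le> 40 / real W * (144 * real W * p) + (40 / real W * 1
      + (real W)\<^sup>2 / 1600 * (328 / (real W)\<^sup>2))"
    using join inv2 nc_E p0 Wpos by (intro add_mono mult_left_mono) auto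
  also have "\<dots> \<le> 5760 * p + (1 / 4 + 1 / 4)"
  proof -
    have "40 / real W * (144 * real W * p) = 5760 * p" using Wpos by simp
    moreover have "40 / real W \<le> 1 / 4" using W(1) by (simp add: field_simps)
    moreover have "(real W)\<^sup>2 / 1600 * (328 / (real W)\<^sup>2) \<le> 1 / 4" using Wpos by simp
    ultimately show ?thesis by simp
  qed
  finally show ?thesis using nc_E unfolding p_def[symmetric] k_def[symmetric] by simp
qed

lemma prob_crosses_antimono:
  assumes "k \<le> k'"
  shows "E (\<lambda>\<sigma>. of_bool (crosses k' \<sigma> s)) \<le> E (\<lambda>\<sigma>. of_bool (crosses k \<sigma> s))"
proof (rule E_mono)
  fix \<sigma>
  have "crosses k' \<sigma> s \<Longrightarrow> crosses k \<sigma> s"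
    using assms by (meson crosses_def le_less_trans)
  then show "of_bool (crosses k' \<sigma> s) \<le> (of_bool (crosses k \<sigma> s) :: real)" by simp
qed

text \<open>
  A union bound over the points at which the cycle might close; \<open>1312 = 4 * 328\<close>.
\<close>

lemma prob_crosses_persists:
  assumes s: "s \<in> {1..n}" and W: "1 \<le> W" "\<beta> * real W \<le> 1" and n: "s + 2 * W + L \<le> n"
  shows "E (\<lambda>\<sigma>. of_bool (crosses (s + W) \<sigma> s)) - real L * (1312 / (real W)\<^sup>2)
    \<le> E (\<lambda>\<sigma>. of_bool (crosses (s + W + L) \<sigma> s))"
  using n
proof (induction L)
  case (Suc L)
  let ?k = "s + W + L"
  have le: "s \<le> ?k" "Suc ?k \<le> n" using Suc.prems by auto
  have "E (\<lambda>\<sigma>. of_bool (crosses ?k \<sigma> s)) - E (\<lambda>\<sigma>. of_bool (crosses (Suc ?k) \<sigma> s))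
      \<le> 4 * E (\<lambda>\<sigma>. 1 / (real (flux ?k \<sigma>) + 1)\<^sup>2)"
    using prob_closes_le[OF s le] prob_closes[OF s le] by simp
  also have "\<dots> \<le> 4 * ((4 + 4 * exp 4) / (real W)\<^sup>2)"
    using W Suc.prems by (intro mult_left_mono inverse_second_moment_flux) auto
  also have "\<dots> \<le> 4 * (328 / (real W)\<^sup>2)"
    using exp_4_le by (intro mult_left_mono divide_right_mono) auto
  finally have "E (\<lambda>\<sigma>. of_bool (crosses ?k \<sigma> s)) - 1312 / (real W)\<^sup>2
      \<le> E (\<lambda>\<sigma>. of_bool (crosses (s + W + Suc L) \<sigma> s))"
    by simp
  moreover have "E (\<lambda>\<sigma>. of_bool (crosses (s + W) \<sigma> s)) - real L * (1312 / (real W)\<^sup>2)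
      \<le> E (\<lambda>\<sigma>. of_bool (crosses ?k \<sigma> s))"
    using Suc by simp
  moreover have "real (Suc L) * (1312 / (real W)\<^sup>2) = 1312 / (real W)\<^sup>2 + real L * (1312 / (real W)\<^sup>2)"
    by (simp only: of_nat_Suc distrib_right mult_1)
  ultimately show ?case by linarith
qed simp

text \<open>
  The length \<open>L\<close> is chosen such that the loss \<open>1312 * L / W\<^sup>2\<close> in the union bound is at most
  \<open>1 / 24000\<close>, half of the lower bound for the crossing probability at \<open>s + W\<close>, whence \<open>31488000 = 1312 * 24000\<close>. As \<open>s\<close>
  lies in the left half and \<open>W, L \<le> n / 8\<close>, all cuts in question have distance at least \<open>W\<close> from \<open>n\<close>.
  Finally \<open>125952000 = 4 * 31488000\<close>, the \<open>4\<close> being due to rounding \<open>W\<close> down.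
\<close>

lemma expected_Max_cycle_ge:
  assumes s: "s \<in> {1..n}" "2 * s \<le> n + 1" and large: "160 \<le> 1 / \<beta>" "160 \<le> real n / 8"
  shows "min (1 / \<beta>\<^sup>2) (real n) \<le> 24000 * 125952000 * E (\<lambda>\<sigma>. real (Max (orbit \<sigma> s)) - real s)"
proof -
  define x where "x = min (1 / \<beta>) (real n / 8)"
  define W where "W = nat \<lfloor>x\<rfloor>"
  define L where "L = nat \<lfloor>min ((real W)\<^sup>2 / 31488000) (real n / 8)\<rfloor>"
  define p where "p k = E (\<lambda>\<sigma>. of_bool (crosses k \<sigma> s))" for k
  have x: "160 \<le> x" using large by (simp add: x_def)
  have W160: "160 \<le> W" using x unfolding W_def by (simp add: le_nat_floor)
  have Wx: "real W \<le> x" "x \<le> 2 * real W"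
    using x W160 unfolding W_def by linarith+
  have \<beta>W: "\<beta> * real W \<le> 1"
  proof -
    have "real W \<le> 1 / \<beta>" using Wx(1) by (simp add: x_def)
    then show ?thesis using \<beta>_pos by (simp add: field_simps)
  qed
  have \<beta>1: "\<beta> \<le> 1" using large(1) \<beta>_pos by (simp add: field_simps)
  have W8: "8 * real W \<le> real n" using Wx(1) by (simp add: x_def)
  have L: "real L \<le> (real W)\<^sup>2 / 31488000" "8 * real L \<le> real n"
    "min ((real W)\<^sup>2 / 31488000) (real n / 8) \<le> real L + 1"
  proof -
    let ?y = "min ((real W)\<^sup>2 / 31488000) (real n / 8)"
    have "0 \<le> ?y" by simp
    then have "real L \<le> ?y" "?y \<le> real L + 1" unfolding L_def by linarith+
    then show "real L \<le> (real W)\<^sup>2 / 31488000" "8 * real L \<le> real n" "?y \<le> real L + 1"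
      by simp_all
  qed
  have n: "s + 2 * W + L \<le> n"
  proof -
    have "8 * W \<le> n" "8 * L \<le> n" "1280 \<le> n"
      using W8 L(2) large(2) by linarith+
    then show ?thesis using s(2) by linarith
  qed
  have M: "min (real n) (2 * (real W + K)) \<le> 16 * real W"
  proof (cases "1 / \<beta> \<le> real n / 8")
    case True
    then have "1 / \<beta> \<le> 2 * real W" using Wx(2) by (simp add: x_def)
    then have "K \<le> 3 * real W" using K_le_inverse[OF \<beta>1] by simp
    then show ?thesis by simp
  next
    case False
    then have "real n \<le> 16 * real W" using Wx(2) by (simp add: x_def)
    then show ?thesis by simp
  qed
  have pW: "1 / 12000 \<le> p (s + W)"
    unfolding p_def using n by (intro prob_crosses_ge s(1) W160 \<beta>W M) auto
  have "real L * (1312 / (real W)\<^sup>2) \<le> (real W)\<^sup>2 / 31488000 * (1312 / (real W)\<^sup>2)"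
    by (intro mult_right_mono L(1)) simp
  also have "\<dots> = 1 / 24000" using W160 by simp
  finally have pL: "1 / 24000 \<le> p (s + W + L)"
    using prob_crosses_persists[OF s(1) _ \<beta>W n] pW W160 unfolding p_def by linarith
  have "(real L + 1) * (1 / 24000) \<le> (\<Sum>k = s + W..s + W + L. p k)"
  proof -
    have "(\<Sum>k = s + W..s + W + L. 1 / 24000) \<le> (\<Sum>k = s + W..s + W + L. p k)"
    proof (rule sum_mono)
      fix k assume "k \<in> {s + W..s + W + L}"
      then have "p (s + W + L) \<le> p k" unfolding p_def by (intro prob_crosses_antimono) auto
      with pL show "1 / 24000 \<le> p k" by linarith
    qed
    then show ?thesis by simp
  qed
  also have "\<dots> \<le> (\<Sum>k = s..<n. p k)"
  proof (rule sum_mono2)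
    show "{s + W..s + W + L} \<subseteq> {s..<n}" using n W160 by auto
    show "0 \<le> p k" for k unfolding p_def by (rule E_nonneg) simp
  qed simp
  also have "\<dots> = E (\<lambda>\<sigma>. real (Max (orbit \<sigma> s)) - real s)"
    unfolding p_def by (rule expected_Max_cycle[OF s(1), symmetric])
  finally have E: "real L + 1 \<le> 24000 * E (\<lambda>\<sigma>. real (Max (orbit \<sigma> s)) - real s)"
    by simp
  have "min (1 / \<beta>\<^sup>2) (real n) \<le> 4 * (real W)\<^sup>2"
  proof -
    have "x\<^sup>2 \<le> (2 * real W)\<^sup>2" using Wx(2) x by (intro power_mono) auto
    moreover have "min (1 / \<beta>\<^sup>2) (real n) \<le> x\<^sup>2"
    proof (cases "1 / \<beta> \<le> real n / 8")
      case True
      then have "x = 1 / \<beta>" by (simp add: x_def)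
      then show ?thesis by (simp add: power_divide)
    next
      case False
      then have x8: "x = real n / 8" by (simp add: x_def)
      have "x\<^sup>2 = real n * (real n / 64)" unfolding x8 by (simp add: power2_eq_square)
      moreover have "real n * 1 \<le> real n * (real n / 64)"
        using large(2) by (intro mult_left_mono) auto
      ultimately show ?thesis by simp
    qed
    ultimately show ?thesis by (simp add: power_mult_distrib)
  qed
  then have "min (1 / \<beta>\<^sup>2) (real n) \<le> 125952000 * min ((real W)\<^sup>2 / 31488000) (real n / 8)"
    by (simp add: min_def split: if_splits)
  also have "\<dots> \<le> 125952000 * (real L + 1)" using L(3) by simp
  also have "\<dots> \<le> 125952000 * (24000 * E (\<lambda>\<sigma>. real (Max (orbit \<sigma> s)) - real s))"
    using E by (intro mult_left_mono) auto
  finally show ?thesis by (simp add: mult_ac)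
qed

lemma expected_diam_ge_half_q:
  assumes s: "s \<in> {1..n}" and n: "2 \<le> n"
  shows "q / 2 \<le> E (\<lambda>\<sigma>. diam \<sigma> s)"
proof -
  note prob_moved[OF s n]
  also have "E (\<lambda>\<sigma>. of_bool (\<sigma> s \<noteq> s)) \<le> E (\<lambda>\<sigma>. diam \<sigma> s)"
  proof (rule E_mono)
    fix \<sigma> assume "\<sigma> permutes {1..n}"
    note c = cycle_facts[OF this s]
    have \<sigma>s: "\<sigma> s \<in> orbit \<sigma> s" by (rule orbit.base)
    have "Min (orbit \<sigma> s) \<le> s" "s \<le> Max (orbit \<sigma> s)" "Min (orbit \<sigma> s) \<le> \<sigma> s" "\<sigma> s \<le> Max (orbit \<sigma> s)"
      using c \<sigma>s by (auto intro: Min_le Max_ge)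
    then show "of_bool (\<sigma> s \<noteq> s) \<le> diam \<sigma> s"
      by (cases "\<sigma> s = s") auto
  qed
  finally show ?thesis .
qed

text \<open>
  For large \<open>1 / \<beta>\<close> and \<open>n\<close> one looks to the right of \<open>s\<close> or of its mirror image, whichever lies in
  the left half. Otherwise the left-hand side is at most a constant times \<open>exp (- 2 * \<beta>)\<close>, and
  moving \<open>s\<close> at all is enough.
\<close>

lemma expected_diam_ge:
  assumes s: "s \<in> {1..n}"
  shows "min (q * max (1 / \<beta>\<^sup>2) 1) (real n - 1) \<le> 24000 * 125952000 * E (\<lambda>\<sigma>. diam \<sigma> s)"
proof -
  define T where "T = min (q * max (1 / \<beta>\<^sup>2) 1) (real n - 1)"
  have s': "n + 1 - s \<in> {1..n}" using s by auto
  have nonneg: "0 \<le> E (\<lambda>\<sigma>. diam \<sigma> s)"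
    unfolding expected_diam[OF s] using Max_cycle_ge_start[OF s] Max_cycle_ge_start[OF s'] by linarith
  have "T \<le> 24000 * 125952000 * E (\<lambda>\<sigma>. diam \<sigma> s)"
  proof (cases "160 \<le> 1 / \<beta> \<and> 160 \<le> real n / 8")
    case True
    then have \<beta>: "\<beta> \<le> 1" using \<beta>_pos by (simp add: field_simps)
    have "T \<le> min (1 / \<beta>\<^sup>2) (real n)"
    proof -
      have "1 \<le> 1 / \<beta>\<^sup>2" using \<beta> \<beta>_pos by (simp add: power_le_one)
      then have "max (1 / \<beta>\<^sup>2) 1 = 1 / \<beta>\<^sup>2" by simp
      moreover have "q * (1 / \<beta>\<^sup>2) \<le> 1 * (1 / \<beta>\<^sup>2)"
        using q_bounds by (intro mult_right_mono) auto
      ultimately have "q * max (1 / \<beta>\<^sup>2) 1 \<le> 1 / \<beta>\<^sup>2" by simp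
      then show ?thesis unfolding T_def by (auto intro: min.mono)
    qed
    also have "\<dots> \<le> 24000 * 125952000 * E (\<lambda>\<sigma>. diam \<sigma> s)"
    proof (cases "2 * s \<le> n + 1")
      case half: True
      show ?thesis
        using expected_Max_cycle_ge[OF s half] True Max_cycle_ge_start[OF s']
        unfolding expected_diam[OF s] by auto
    next
      case False
      then have half: "2 * (n + 1 - s) \<le> n + 1" by auto
      show ?thesis
        using expected_Max_cycle_ge[OF s' half] True Max_cycle_ge_start[OF s]
        unfolding expected_diam[OF s] by auto
    qed
    finally show ?thesis .
  next
    case False
    show ?thesis
    proof (cases "n = 1")
      case True
      then have "T \<le> 0" by (simp add: T_def)
      also have "0 \<le> 24000 * 125952000 * E (\<lambda>\<sigma>. diam \<sigma> s)" using nonneg by simp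
      finally show ?thesis .
    next
      case n1: False
      then have n2: "2 \<le> n" using s by auto
      have "T \<le> 25600 * q"
      proof (cases "1 \<le> \<beta>")
        case True
        then have "1 / \<beta>\<^sup>2 \<le> 1" by simp
        then have "T \<le> q" by (simp add: T_def max_def)
        then show ?thesis using q_bounds by simp
      next
        case \<beta>1: False
        show ?thesis
        proof (cases "160 \<le> 1 / \<beta>")
          case True
          with False have "real n - 1 \<le> 1280 * 1" by simp
          also have "\<dots> \<le> 1280 * (9 * q)" using q_ge \<beta>1 by (intro mult_left_mono) auto
          finally have "T \<le> 11520 * q" by (simp add: T_def)
          then show ?thesis using q_bounds by simp
        next
          case False
          then have "(1 / \<beta>)\<^sup>2 \<le> 160\<^sup>2" using \<beta>_pos by (intro power_mono) auto
          then have "max (1 / \<beta>\<^sup>2) 1 \<le> 25600" by (simp add: power_divide)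
          then have "q * max (1 / \<beta>\<^sup>2) 1 \<le> q * 25600" using q_bounds by (intro mult_left_mono) auto
          then show ?thesis by (simp add: T_def)
        qed
      qed
      also have "\<dots> \<le> 51200 * E (\<lambda>\<sigma>. diam \<sigma> s)"
        using expected_diam_ge_half_q[OF s n2] by simp
      also have "\<dots> \<le> 24000 * 125952000 * E (\<lambda>\<sigma>. diam \<sigma> s)"
        using nonneg by (intro mult_right_mono) auto
      finally show ?thesis .
    qed
  qed
  then show ?thesis by (simp add: T_def)
qed

end

theorem theorem1p2:
  shows "\<exists>(c::real) > 0. \<exists>(C::real) > 0. \<forall>(n::nat) \<ge> 1. \<forall>(\<beta>::real) > 0. \<forall>s \<in> {1..n}.
    c * min (exp (- 2 * \<beta>) * max (1 / \<beta>\<^sup>2) 1) (real n - 1)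
      \<le> measure_pmf.expectation (mallows_pmf n \<beta>)
          (\<lambda>\<sigma>. real (Max (cycle_of s \<sigma>)) - real (Min (cycle_of s \<sigma>))) \<and>
    measure_pmf.expectation (mallows_pmf n \<beta>)
          (\<lambda>\<sigma>. real (Max (cycle_of s \<sigma>)) - real (Min (cycle_of s \<sigma>)))
      \<le> C * min (exp (- 2 * \<beta>) * max (1 / \<beta>\<^sup>2) 1) (real n - 1)"
proof (rule exI[of _ "1 / (24000 * 125952000)"], rule conjI, simp,
    rule exI[of _ 3328], intro conjI allI impI ballI)
  fix n s :: nat and \<beta> :: real
  assume "0 < \<beta>" and s: "s \<in> {1..n}"
  then interpret mallows n \<beta> by unfold_locales
  show "1 / (24000 * 125952000) * min (exp (- 2 * \<beta>) * max (1 / \<beta>\<^sup>2) 1) (real n - 1) \<le> E (\<lambda>\<sigma>. diam \<sigma> s)"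
    using expected_diam_ge[OF s] unfolding q_def by simp
  show "E (\<lambda>\<sigma>. diam \<sigma> s) \<le> 3328 * min (exp (- 2 * \<beta>) * max (1 / \<beta>\<^sup>2) 1) (real n - 1)"
    using expected_diam_le[OF s] unfolding q_def .
qed simp_all

end
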